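(* Let $f: M \to M$ be a continuous map on a compact Riemannian manifold $M$, and let $\mu$ be an $f$-invariant Borel probability measure. Then $\mu$ is empirically stochastically stable if and only if it is physical. Besides, if $\mu$ is physical, then its basin $\widehat A_{\mu} \subset M$ of empiric stochastic stability equals Lebesgue-a.e. its strong basin $A_{\mu} \subset M$ of statistical attraction.
   Context: Setting. $M$ is a compact finite-dimensional Riemannian manifold, with or without boundary; $m$ is the Lebesgue measure on $M$, i.e. the finite Borel measure obtained from the Riemannian volume; $B_\epsilon(x)$ is the open ball of radius $\epsilon$ centered at $x$. "Lebesgue-a.e." refers to $m$; two sets are equal Lebesgue-a.e. if their symmetric difference has zero $m$-measure. $\mathcal{M}$ is the space of Borel probability measures on $M$ with the weak$^*$ topology, and $\mathrm{dist}^*$ is a fixed metric on $\mathcal{M}$ inducing that topology. $\mathcal{M}_f\subset\mathcal{M}$ is the set of $f$-invariant probability measures. $\mathbb{N}^+=\{1,2,\dots\}$. Noise. For $\epsilon>0$, $x\in M$ and a Borel set $A$, let $p_\epsilon(x,A)=\dfrac{m(A\cap B_\epsilon(f(x)))}{m(B_\epsilon(f(x)))}$. The transfer operator $\mathcal{L}_\epsilon$ on the space $C^0(M,\mathbb{C})$ of continuous functions is $(\mathcal{L}_\epsilon\varphi)(x)=\int\varphi(y)\,p_\epsilon(x,dy)$; the dual operator $\mathcal{L}_\epsilon^*:\mathcal{M}\to\mathcal{M}$ is defined by $\int\varphi\,d(\mathcal{L}^*_\epsilon\mu)=\int(\mathcal{L}_\epsilon\varphi)\,d\mu$ for all $\varphi\in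 C^0(M,\mathbb{C})$. The empiric stochastic probability is $\sigma_{\epsilon,n,x}=\frac1n\sum_{j=1}^n(\mathcal{L}_\epsilon^* )^j\delta_x$, where $\delta_x$ is the Dirac measure at $x$. Empiric stochastic stability. A measure $\mu\in\mathcal{M}_f$ is empirically stochastically stable if there is a measurable set $\widehat A\subset M$ with $m(\widehat A)>0$ such that for every $\rho>0$ and every large enough $n\in\mathbb{N}^+$ (how large may depend on $\rho$) there exists $\epsilon_0>0$ (which may depend on $\rho$ and $n$ but not on $x$) with $\mathrm{dist}^*(\sigma_{\epsilon,n,x},\mu)<\rho$ for all $0<\epsilon\le\epsilon_0$ and for Lebesgue-a.e. $x\in\widehat A$. The basin of empiric stochastic stability $\widehat A_\mu$ of $\mu$ is the set of $x\in M$ such that for every $\rho>0$ there is $N=N(\rho)$ such that for every $n\ge N$ there is $\epsilon_0=\epsilon_0(\rho,n)>0$ with $\mathrm{dist}^*(\sigma_{\epsilon,n,x},\mu)<\rho$ for all $0<\epsilon\le\epsilon_0$. Physical measures. Let $\sigma_{n,x}=\frac1n\sum_{j=1}^n\delta_{f^j(x)}$ and let $p\omega_x\subset\mathcal{M}$ be the set of all weak$^*$ limits of convergent subsequences $\sigma_{n_i,x}$ with $n_i\to+\infty$. The strong basin of statistical attraction of $\mu\in\mathcal{M}_f$ is $A_\mu=\{x\in M: p\omega_x=\{\mu\}\}$. The measure $\mu$ is physical if $m(A_\mu)>0$. *)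

theory Defs
  imports "HOL-Probability.Probability"
begin

text \<open>In finite dimension, asking for \<open>C_k\<close> directional derivatives is the same as asking for a
  \<open>C_k\<close> derivative. \<open>C_k_on k F W\<close> is the usual notion only for open \<open>W\<close>; for the relatively open
  subsets of a half-space that occur at a boundary, use \<open>smooth_on\<close>, which asks for local
  smooth extensions.\<close>

primrec C_k_on :: "nat \<Rightarrow> ('e::euclidean_space \<Rightarrow> 'b::real_normed_vector) \<Rightarrow> 'e set \<Rightarrow> bool" where
  "C_k_on 0 F W \<longleftrightarrow> continuous_on W F"
| "C_k_on (Suc k) F W \<longleftrightarrow>
     (\<exists>F'. (\<forall>y\<in>W. (F has_derivative F' y) (at y)) \<and> (\<forall>v. C_k_on k (\<lambda>y. F' y v) W))"

definition smooth_on :: "'e::euclidean_space set \<Rightarrow> ('e \<Rightarrow> 'b::real_normed_vector) \<Rightarrow> bool" where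
  "smooth_on S h \<longleftrightarrow>
     (\<forall>y\<in>S. \<exists>W F. open W \<and> y \<in> W \<and> (\<forall>k. C_k_on k F W) \<and> (\<forall>z\<in>W \<inter> S. F z = h z))"

text \<open>The manifold is a type of class \<open>metric_space\<close>, so that the Hausdorff property (and, under
  compactness, second countability) need not be assumed. A chart is a pair of an open domain and a
  coordinate map.\<close>

type_synonym ('a, 'n) chart = "'a set \<times> ('a \<Rightarrow> real ^ 'n)"

abbreviation half_space :: "'n::finite \<Rightarrow> (real ^ 'n) set" where
  "half_space k \<equiv> {v. 0 \<le> v $ k}"

definition is_chart :: "('a::topological_space, 'n::finite) chart \<Rightarrow> bool" where
  "is_chart = (\<lambda>(U, \<phi>). open U \<and> homeomorphism U (\<phi> ` U) \<phi> (inv_into U \<phi>) \<and>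
     (open (\<phi> ` U) \<or> (\<exists>k. openin (top_of_set (half_space k)) (\<phi> ` U))))"

definition transition :: "('a, 'n) chart \<Rightarrow> ('a, 'n) chart \<Rightarrow> real ^ 'n \<Rightarrow> real ^ 'n" where
  "transition = (\<lambda>(U, \<phi>) (V, \<psi>). \<psi> \<circ> inv_into U \<phi>)"

definition smooth_atlas :: "('a::topological_space, 'n::finite) chart set \<Rightarrow> bool" where
  "smooth_atlas A \<longleftrightarrow>
     (\<forall>c\<in>A. is_chart c) \<and> (\<Union>c\<in>A. fst c) = UNIV \<and>
     (\<forall>c\<in>A. \<forall>d\<in>A. smooth_on (snd c ` (fst c \<inter> fst d)) (transition c d))"

text \<open>A Riemannian metric is given by its coordinate expressions: \<open>g c p v w\<close> is the inner product
  at \<open>p\<close> of the tangent vectors whose coordinates in the chart \<open>c\<close> are \<open>v\<close> and \<open>w\<close>. The last clause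
  is the transformation rule under a change of coordinates.\<close>

type_synonym ('a, 'n) metric_tensor =
  "('a, 'n) chart \<Rightarrow> 'a \<Rightarrow> real ^ 'n \<Rightarrow> real ^ 'n \<Rightarrow> real"

definition riemannian_metric ::
  "('a::topological_space, 'n::finite) chart set \<Rightarrow> ('a, 'n) metric_tensor \<Rightarrow> bool" where
  "riemannian_metric A g \<longleftrightarrow>
     (\<forall>c\<in>A. \<forall>p\<in>fst c. bilinear (g c p) \<and> (\<forall>v w. g c p v w = g c p w v) \<and>
        (\<forall>v. v \<noteq> 0 \<longrightarrow> 0 < g c p v v)) \<and>
     (\<forall>c\<in>A. \<forall>v w. smooth_on (snd c ` fst c) (\<lambda>y. g c (inv_into (fst c) (snd c) y) v w)) \<and>
     (\<forall>c\<in>A. \<forall>d\<in>A. \<forall>p\<in>fst c \<inter> fst d. \<forall>D.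
        (transition c d has_derivative D) (at (snd c p) within snd c ` (fst c \<inter> fst d)) \<longrightarrow>
        (\<forall>v w. g c p v w = g d p (D v) (D w)))"

text \<open>\<open>curve_joins A g x y l\<close>: some piecewise continuously differentiable curve of length \<open>l\<close> leads
  from \<open>x\<close> to \<open>y\<close>. By compactness of the parameter interval every such curve is a
  concatenation of finitely many pieces, each contained in the domain of one chart.\<close>

inductive curve_joins ::
  "('a::topological_space, 'n::finite) chart set \<Rightarrow> ('a, 'n) metric_tensor \<Rightarrow> 'a \<Rightarrow> 'a \<Rightarrow> real \<Rightarrow> bool"
  for A g where
  refl: "curve_joins A g x x 0"
| step: "curve_joins A g x (\<gamma> 0) l \<Longrightarrow> c \<in> A \<Longrightarrow> \<gamma> ` {0..1} \<subseteq> fst c \<Longrightarrow>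
     (\<And>t. t \<in> {0..1} \<Longrightarrow> ((\<lambda>s. snd c (\<gamma> s)) has_vector_derivative u t) (at t within {0..1})) \<Longrightarrow>
     continuous_on {0..1} u \<Longrightarrow>
     curve_joins A g x (\<gamma> 1) (l + integral {0..1} (\<lambda>t::real. sqrt (g c (\<gamma> t) (u t) (u t))))"

text \<open>Points of different components are joined by no curve, and their (finite) distance is left
  unspecified: no canonical value exists, and small balls do not depend on it.\<close>

definition riemannian_dist ::
  "('a::metric_space, 'n::finite) chart set \<Rightarrow> ('a, 'n) metric_tensor \<Rightarrow> bool" where
  "riemannian_dist A g \<longleftrightarrow>
     (\<forall>x y. (\<exists>l. curve_joins A g x y l) \<longrightarrow> dist x y = Inf {l. curve_joins A g x y l})"

text \<open>In a chart the Riemannian volume has the density \<open>sqrt (det (g\<^sub>i\<^sub>j))\<close>. Since the chart domains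
  form an open cover, this determines the Borel measure \<open>m\<close>.\<close>

definition riemannian_volume :: "('a::topological_space, 'n::finite) chart set \<Rightarrow>
    ('a, 'n) metric_tensor \<Rightarrow> 'a measure \<Rightarrow> bool" where
  "riemannian_volume A g m \<longleftrightarrow> sets m = sets borel \<and>
     (\<forall>(U, \<phi>)\<in>A. \<forall>B\<in>sets borel. B \<subseteq> U \<longrightarrow>
        emeasure m B = (\<integral>\<^sup>+y\<in>\<phi> ` B. ennreal (sqrt (det (\<chi> i j.
          g (U, \<phi>) (inv_into U \<phi> y) (axis i 1) (axis j 1)))) \<partial>lborel))"

text \<open>The type \<open>'a\<close> is a compact Riemannian manifold and \<open>m\<close> is its Lebesgue measure. The second
  alternative is dimension 0, for which there is no model space \<open>real ^ 'n\<close>: a compact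
  0-dimensional manifold is a finite discrete space, and its volume is the counting measure.\<close>

definition compact_riemannian_manifold :: "('a::metric_space, 'n::finite) chart set \<Rightarrow>
    ('a, 'n) metric_tensor \<Rightarrow> 'a measure \<Rightarrow> bool" where
  "compact_riemannian_manifold A g m \<longleftrightarrow> compact (UNIV :: 'a set) \<and>
     (smooth_atlas A \<and> riemannian_metric A g \<and> riemannian_dist A g \<and> riemannian_volume A g m \<or>
      finite (UNIV :: 'a set) \<and> m = count_space UNIV)"

definition borel_probs :: "'a::topological_space measure set" where
  "borel_probs = {\<mu>. sets \<mu> = sets borel \<and> prob_space \<mu>}"

definition invariant_probs :: "('a::topological_space \<Rightarrow> 'a) \<Rightarrow> 'a measure set" where
  "invariant_probs f = {\<mu> \<in> borel_probs. distr \<mu> borel f = \<mu>}"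

definition weak_star :: "'a::topological_space measure topology" where
  "weak_star = topology_generated_by
     {{\<nu> \<in> borel_probs. integral\<^sup>L \<nu> \<phi> \<in> W} | (\<phi> :: 'a \<Rightarrow> complex) W.
        continuous_on UNIV \<phi> \<and> open W}"

text \<open>Meaningful only for \<open>n \<ge> 1\<close>; \<open>n = 0\<close> gives the null measure.\<close>

definition average_measure :: "(nat \<Rightarrow> 'a::topological_space measure) \<Rightarrow> nat \<Rightarrow> 'a measure" where
  "average_measure \<nu> n =
     measure_of UNIV (sets borel) (\<lambda>B. (\<Sum>j = 1..n. emeasure (\<nu> j) B) / of_nat n)"

text \<open>\<open>uniform_measure m S\<close> is the measure \<open>B \<mapsto> m (S \<inter> B) / m S\<close>.\<close>

definition noise_kernel ::
  "'a::metric_space measure \<Rightarrow> ('a \<Rightarrow> 'a) \<Rightarrow> real \<Rightarrow> 'a \<Rightarrow> 'a measure" where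
  "noise_kernel m f \<epsilon> x = uniform_measure m (ball (f x) \<epsilon>)"

definition transfer_op ::
  "'a::metric_space measure \<Rightarrow> ('a \<Rightarrow> 'a) \<Rightarrow> real \<Rightarrow> ('a \<Rightarrow> complex) \<Rightarrow> 'a \<Rightarrow> complex" where
  "transfer_op m f \<epsilon> \<phi> x = (\<integral>y. \<phi> y \<partial>noise_kernel m f \<epsilon> x)"

definition dual_transfer_op ::
  "'a::metric_space measure \<Rightarrow> ('a \<Rightarrow> 'a) \<Rightarrow> real \<Rightarrow> 'a measure \<Rightarrow> 'a measure" where
  "dual_transfer_op m f \<epsilon> \<mu> = (THE \<nu>. \<nu> \<in> borel_probs \<and>
     (\<forall>\<phi> :: 'a \<Rightarrow> complex. continuous_on UNIV \<phi> \<longrightarrow>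
        (\<integral>x. \<phi> x \<partial>\<nu>) = (\<integral>x. transfer_op m f \<epsilon> \<phi> x \<partial>\<mu>)))"

definition empiric_stochastic ::
  "'a::metric_space measure \<Rightarrow> ('a \<Rightarrow> 'a) \<Rightarrow> real \<Rightarrow> nat \<Rightarrow> 'a \<Rightarrow> 'a measure" where
  "empiric_stochastic m f \<epsilon> n x =
     average_measure (\<lambda>j. (dual_transfer_op m f \<epsilon> ^^ j) (return borel x)) n"

text \<open>In the following two definitions \<open>d\<close> is a metric for the weak* topology.\<close>

definition empirically_stochastically_stable ::
  "'a::metric_space measure \<Rightarrow> ('a \<Rightarrow> 'a) \<Rightarrow> ('a measure \<Rightarrow> 'a measure \<Rightarrow> real) \<Rightarrow>
    'a measure \<Rightarrow> bool" where
  "empirically_stochastically_stable m f d \<mu> \<longleftrightarrow> \<mu> \<in> invariant_probs f \<and>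
     (\<exists>S\<in>sets m. 0 < emeasure m S \<and>
        (\<forall>\<rho>>0. \<exists>N\<ge>1. \<forall>n\<ge>N. \<exists>\<epsilon>0>0. \<forall>\<epsilon>. 0 < \<epsilon> \<and> \<epsilon> \<le> \<epsilon>0 \<longrightarrow>
           (AE x in m. x \<in> S \<longrightarrow> d (empiric_stochastic m f \<epsilon> n x) \<mu> < \<rho>)))"

definition stochastic_basin ::
  "'a::metric_space measure \<Rightarrow> ('a \<Rightarrow> 'a) \<Rightarrow> ('a measure \<Rightarrow> 'a measure \<Rightarrow> real) \<Rightarrow>
    'a measure \<Rightarrow> 'a set" where
  "stochastic_basin m f d \<mu> =
     {x. \<forall>\<rho>>0. \<exists>N\<ge>1. \<forall>n\<ge>N. \<exists>\<epsilon>0>0. \<forall>\<epsilon>. 0 < \<epsilon> \<and> \<epsilon> \<le> \<epsilon>0 \<longrightarrow>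
        d (empiric_stochastic m f \<epsilon> n x) \<mu> < \<rho>}"

definition empiric :: "('a::topological_space \<Rightarrow> 'a) \<Rightarrow> nat \<Rightarrow> 'a \<Rightarrow> 'a measure" where
  "empiric f n x = average_measure (\<lambda>j. return borel ((f ^^ j) x)) n"

definition p_omega :: "('a::topological_space \<Rightarrow> 'a) \<Rightarrow> 'a \<Rightarrow> 'a measure set" where
  "p_omega f x =
     {\<nu>. \<exists>r :: nat \<Rightarrow> nat. strict_mono r \<and>
        limitin weak_star (\<lambda>i. empiric f (r i) x) \<nu> sequentially}"

definition strong_basin :: "('a::topological_space \<Rightarrow> 'a) \<Rightarrow> 'a measure \<Rightarrow> 'a set" where
  "strong_basin f \<mu> = {x. p_omega f x = {\<mu>}}"

text \<open>The value of \<open>emeasure\<close> on a non-measurable set is 0, so positivity includes measurability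
  of the basin.\<close>

definition physical ::
  "'a::topological_space measure \<Rightarrow> ('a \<Rightarrow> 'a) \<Rightarrow> 'a measure \<Rightarrow> bool" where
  "physical m f \<mu> \<longleftrightarrow> \<mu> \<in> invariant_probs f \<and> 0 < emeasure m (strong_basin f \<mu>)"

end

theory Submission
  imports Defs
begin

text \<open>For a fixed length \<open>n\<close> of the orbit, the noise disappears as \<open>\<epsilon> \<rightarrow> 0\<close>, and it does so uniformly in the
  starting point: \<open>empiric_stochastic m f \<epsilon> n x\<close> is within any given \<open>\<rho>\<close> of \<open>empiric f n x\<close> for all \<open>x\<close>
  as soon as \<open>\<epsilon>\<close> is small enough (lemma \<open>empiric_stochastic_uniformly_close\<close>). Both stability and the
  stochastic basin take the limit \<open>\<epsilon> \<rightarrow> 0\<close> before \<open>n \<rightarrow> \<infinity>\<close>, so the noise can be dropped from them at the cost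
  of replacing \<open>\<rho>\<close> by \<open>2 \<rho>\<close>. What is left are statements about the noiseless averages:

  \<^item> \<open>x\<close> is in the stochastic basin iff \<open>empiric f n x\<close> converges to \<open>\<mu>\<close>;
  \<^item> \<open>\<mu>\<close> is stable iff this convergence is uniform, up to a null set for every \<open>n\<close>, on some set of positive
    volume.

  On the other hand \<open>p_omega f x = {\<mu>}\<close> means the same as \<open>empiric f n x \<rightarrow> \<mu>\<close>, because the probabilities on a
  compact metric space are weak* sequentially compact (\<open>borel_probs_sequentially_compact\<close>). Hence the two
  basins are equal, even pointwise. A stable measure is physical since almost every point of the set
  that witnesses stability lies in the strong basin; a physical measure is stable since, by Egorov's
  theorem (\<open>egorov_positive_set\<close>), pointwise convergence on the strong basin is uniform on a subset of
  positive volume.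

  The Riemannian structure enters through three facts: the manifold is compact, its volume is finite, and
  nonempty open sets have positive volume. They make the noise kernel a measurable family of
  probabilities, by lower semicontinuity of the volume of \<open>ball (f x) \<epsilon> \<inter> B\<close> in \<open>x\<close>, and the dual operator is
  then composition with this kernel in the Giry monad.

  The compactness theorem is reduced to Helly's selection theorem on the real line. A compact metric
  space has a Borel injection into a bounded interval whose inverse is uniformly continuous; the inverse
  extends to a continuous map on the closure of the range, along which the limit measure is pushed back.\<close>

section \<open>Riemannian volume of open sets\<close>

text \<open>Along the segment from the identity to \<open>G\<close> all matrices are positive definite, hence invertible;
  the determinant starts at 1 and cannot change its sign.\<close>

lemma det_pos_if_positive_definite:
  fixes G :: "real ^ 'n ^ 'n"
  assumes pos: "\<And>v. v \<noteq> 0 \<Longrightarrow> 0 < v \<bullet> (G *v v)"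
  shows "0 < det G"
proof -
  define H :: "real \<Rightarrow> real ^ 'n ^ 'n" where "H t = (1 - t) *\<^sub>R mat 1 + t *\<^sub>R G" for t
  have H_v: "H t *v v = (1 - t) *\<^sub>R v + t *\<^sub>R (G *v v)" for t v
    by (simp add: H_def matrix_vector_mult_add_rdistrib scaleR_matrix_vector_assoc[symmetric])
  have nz: "det (H t) \<noteq> 0" if t: "t \<in> {0..1}" for t
  proof -
    have "v = 0" if "H t *v v = 0" for v
    proof (rule ccontr)
      assume v: "v \<noteq> 0"
      have "0 = v \<bullet> (H t *v v)" using that by simp
      also have "\<dots> = (1 - t) * (v \<bullet> v) + t * (v \<bullet> (G *v v))"
        by (simp add: H_v inner_add_right)
      also have "\<dots> > 0"
      proof (cases "t = 0")
        case False
        then show ?thesis using pos[OF v] t by (simp add: add_nonneg_pos)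
      qed (use v in simp)
      finally show False by simp
    qed
    then show ?thesis
      by (metis matrix_left_invertible_ker invertible_left_inverse invertible_det_nz)
  qed
  have cont: "continuous_on {0..1} (\<lambda>t. det (H t))"
    unfolding det_def H_def by (auto intro!: continuous_intros)
  have "det (H 0) = 1" "det (H 1) = det G" by (simp_all add: H_def)
  moreover have "\<exists>t\<ge>0. t \<le> 1 \<and> det (H t) = 0" if "det (H 1) \<le> 0"
    using IVT2'[of "\<lambda>t. det (H t)" 1 0 0] that cont \<open>det (H 0) = 1\<close> by auto
  ultimately show ?thesis using nz by fastforce
qed

definition gram :: "(real ^ 'n \<Rightarrow> real ^ 'n \<Rightarrow> real) \<Rightarrow> real ^ 'n ^ 'n" where
  "gram b = (\<chi> i j. b (axis i 1) (axis j 1))"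

lemma det_gram_pos:
  fixes b :: "real ^ 'n \<Rightarrow> real ^ 'n \<Rightarrow> real"
  assumes b: "bilinear b" and pos: "\<And>v. v \<noteq> 0 \<Longrightarrow> 0 < b v v"
  shows "0 < det (gram b)"
proof (rule det_pos_if_positive_definite)
  fix v :: "real ^ 'n" assume v: "v \<noteq> 0"
  have L: "linear (\<lambda>y. b x y)" "linear (\<lambda>y. b y x)" for x using b by (auto simp: bilinear_def)
  have "b v v = b (\<Sum>i\<in>UNIV. v $ i *\<^sub>R axis i 1) (\<Sum>j\<in>UNIV. v $ j *\<^sub>R axis j 1)"
    using basis_expansion[of v] by (simp add: scalar_mult_eq_scaleR)
  also have "\<dots> = (\<Sum>i\<in>UNIV. \<Sum>j\<in>UNIV. v $ i * (v $ j * b (axis i 1) (axis j 1)))"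
    by (simp add: linear_sum[OF L(1)] linear_sum[OF L(2)] linear_scale[OF L(1)]
        linear_scale[OF L(2)] sum_distrib_left) (subst sum.swap, simp add: mult_ac)
  also have "\<dots> = v \<bullet> (gram b *v v)"
    by (simp add: gram_def inner_vec_def matrix_vector_mult_def sum_distrib_left mult_ac)
  finally show "0 < v \<bullet> (gram b *v v)" using pos[OF v] by simp
qed

text \<open>Around each point \<open>h\<close> agrees on \<open>S\<close> with a function that is continuous on an open set.\<close>

lemma smooth_on_imp_continuous_on:
  assumes "smooth_on S h"
  shows "continuous_on S h"
  unfolding continuous_on_eq_continuous_within
proof
  fix y assume "y \<in> S"
  then obtain W F where W: "open W" "y \<in> W" "C_k_on 0 F W" "\<forall>z\<in>W \<inter> S. F z = h z"
    using assms unfolding smooth_on_def by blast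
  have "isCont F y"
    using W by (simp add: continuous_on_eq_continuous_at)
  then have "continuous (at y within S) F" by (rule continuous_at_imp_continuous_at_within)
  moreover have "\<forall>\<^sub>F z in at y within S. F z = h z"
    using W unfolding eventually_at_topological by blast
  ultimately show "continuous (at y within S) h"
    unfolding continuous_within using W \<open>y \<in> S\<close>
    by (metis Int_iff tendsto_cong)
qed

lemma compact_UNIV_finite_measure_if_locally_finite:
  fixes m :: "'a::topological_space measure"
  assumes "compact (UNIV :: 'a set)" "sets m = sets borel"
    and loc: "\<And>p. \<exists>B. open B \<and> p \<in> B \<and> emeasure m B < \<infinity>"
  shows "finite_measure m"
proof -
  obtain B where B: "\<And>p. open (B p) \<and> p \<in> B p \<and> emeasure m (B p) < \<infinity>" using loc by metis
  have "\<exists>C\<subseteq>UNIV. finite C \<and> UNIV \<subseteq> (\<Union>p\<in>C. B p)"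
    by (rule compactE_image[OF assms(1), of UNIV B]) (use B in auto)
  then obtain C where C: "finite C" "(\<Union>p\<in>C. B p) = UNIV" by auto
  have sp: "space m = UNIV" using sets_eq_imp_space_eq[OF assms(2)] by simp
  have "emeasure m (\<Union>p\<in>C. B p) \<le> (\<Sum>p\<in>C. emeasure m (B p))"
    by (rule emeasure_subadditive_finite) (use B C assms(2) in auto)
  also have "\<dots> < \<infinity>" using B C by (simp add: less_top)
  finally show ?thesis using C sp by (intro finite_measureI) auto
qed

text \<open>In a chart the density is continuous and positive on the image \<open>W\<close> of the chart domain. Continuity bounds
  it above near a point, which gives a neighbourhood of finite volume; a positive lower bound on a ball
  gives positive volume.\<close>

lemma
  fixes A :: "('a::metric_space, 'n::finite) chart set"
  assumes atlas: "smooth_atlas A" and met: "riemannian_metric A g"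
    and vol: "riemannian_volume A g m"
  shows riemannian_volume_locally_finite: "\<exists>B. open B \<and> p \<in> B \<and> emeasure m B < \<infinity>"
    and riemannian_volume_open_pos: "open V \<Longrightarrow> p \<in> V \<Longrightarrow> 0 < emeasure m V"
proof -
  obtain U \<phi> where c: "(U, \<phi>) \<in> A" and p: "p \<in> U"
    using atlas unfolding smooth_atlas_def by (metis UNIV_I UN_iff prod.collapse)
  define W where "W = \<phi> ` U"
  define inv where "inv = inv_into U \<phi>"
  have "is_chart (U, \<phi>)" using atlas c unfolding smooth_atlas_def by blast
  then have U: "open U" and hom: "homeomorphism U W \<phi> inv"
    and W: "open W \<or> (\<exists>k. openin (top_of_set (half_space k)) W)"
    by (auto simp: is_chart_def W_def inv_def)
  define \<delta> where "\<delta> y = sqrt (det (gram (g (U, \<phi>) (inv y))))" for y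
  have cont: "continuous_on W \<delta>"
  proof -
    have "continuous_on W (\<lambda>y. g (U, \<phi>) (inv y) v w)" for v w
      using met c unfolding riemannian_metric_def W_def inv_def
      by (force intro!: smooth_on_imp_continuous_on)
    then show ?thesis unfolding \<delta>_def gram_def det_def by (auto intro!: continuous_intros)
  qed
  have pos: "0 < \<delta> y" if "y \<in> W" for y
  proof -
    have "inv y \<in> U" using hom that unfolding homeomorphism_def by blast
    then show ?thesis
      using met c unfolding \<delta>_def riemannian_metric_def
      by (force intro!: det_gram_pos)
  qed
  have m: "emeasure m B = (\<integral>\<^sup>+y. \<delta> y * indicator (\<phi> ` B) y \<partial>lborel)"
    if "B \<in> sets borel" "B \<subseteq> U" for B
    using vol c that unfolding riemannian_volume_def \<delta>_def gram_def inv_def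
    by (auto simp: split_beta ennreal_indicator[symmetric] ennreal_mult'' nn_integral_set_ennreal)
  have sets_m: "sets m = sets borel" using vol by (simp add: riemannian_volume_def)
  show "\<exists>B. open B \<and> p \<in> B \<and> emeasure m B < \<infinity>"
  proof -
    have pW: "\<phi> p \<in> W" using p by (simp add: W_def)
    obtain e where e: "e > 0" "\<And>y. y \<in> W \<Longrightarrow> dist y (\<phi> p) < e \<Longrightarrow> dist (\<delta> y) (\<delta> (\<phi> p)) < 1"
      using cont pW unfolding continuous_on_iff by (metis zero_less_one)
    define B where "B = U \<inter> \<phi> -` ball (\<phi> p) e"
    have cU: "continuous_on U \<phi>" using hom by (simp add: homeomorphism_def)
    have B: "open B" unfolding B_def
      using continuous_open_preimage[OF cU U open_ball] .
    have "emeasure m B = (\<integral>\<^sup>+y. \<delta> y * indicator (\<phi> ` B) y \<partial>lborel)"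
      by (rule m) (use B in \<open>auto simp: B_def\<close>)
    also have "\<dots> \<le> (\<integral>\<^sup>+y. ennreal (\<delta> (\<phi> p) + 1) * indicator (ball (\<phi> p) e) y \<partial>lborel)"
    proof (rule nn_integral_mono)
      fix y
      show "ennreal (\<delta> y * indicator (\<phi> ` B) y) \<le> ennreal (\<delta> (\<phi> p) + 1) * indicator (ball (\<phi> p) e) y"
      proof (cases "y \<in> \<phi> ` B")
        case True
        then have y: "y \<in> W" "dist y (\<phi> p) < e" by (auto simp: B_def W_def dist_commute)
        with e(2)[OF this] True show ?thesis
          by (auto simp: dist_real_def dist_commute intro!: ennreal_leI)
      qed simp
    qed
    also have "\<dots> < \<infinity>"
      by (subst nn_integral_cmult_indicator)
        (use emeasure_lborel_ball_finite[of "\<phi> p" e] in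
          \<open>auto simp: ennreal_mult_less_top\<close>)
    finally show ?thesis using B p e(1) by (auto simp: B_def)
  qed
  show "0 < emeasure m V" if V: "open V" "p \<in> V"
  proof -
    define B where "B = V \<inter> U"
    have B: "open B" "p \<in> B" "B \<subseteq> U" using U V p by (auto simp: B_def)
    have op: "openin (top_of_set W) (\<phi> ` B)"
      by (rule homeomorphism_imp_open_map[OF hom]) (use B U in \<open>simp add: openin_open_eq\<close>)
    have ne: "\<phi> p \<in> \<phi> ` B" using B by blast
    \<comment> \<open>At a boundary point \<open>\<phi> ` B\<close> is open only in a half-space; moving a little inwards from \<open>\<phi> p\<close>
    shows that its interior is still nonempty.\<close>
    obtain Q where Q: "open Q" "Q \<noteq> {}" "Q \<subseteq> \<phi> ` B"
    proof (cases "open W")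
      case True
      then show ?thesis using op ne that openin_open_eq by blast
    next
      case False
      then obtain k where k: "openin (top_of_set (half_space k)) W" using W by auto
      obtain R where R: "open R" "\<phi> ` B = half_space k \<inter> R"
        using openin_trans[OF op k] unfolding openin_open by blast
      obtain e where e: "e > 0" "ball (\<phi> p) e \<subseteq> R"
        using R ne by (metis Int_iff open_contains_ball)
      define z where "z = \<phi> p + (e / 2) *\<^sub>R axis k 1"
      have "dist (\<phi> p) z < e" using e by (simp add: z_def dist_norm norm_axis_1)
      moreover have "0 < z $ k" using ne R e by (auto simp: z_def axis_def intro: add_nonneg_pos)
      moreover have "open (R \<inter> {v. 0 < v $ k})"
        by (intro open_Int R open_Collect_less continuous_intros)
      ultimately show ?thesis
        using R e by (intro that[of "R \<inter> {v. 0 < v $ k}"]) (auto intro!: exI[of _ z])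
    qed
    then obtain z where z: "z \<in> Q" by auto
    have BW: "\<phi> ` B \<subseteq> W" using B by (auto simp: W_def)
    have zW: "z \<in> W" using z Q BW by auto
    obtain r where r: "r > 0" "ball z r \<subseteq> Q" using Q z open_contains_ball by blast
    obtain e where e: "e > 0" "\<And>y. y \<in> W \<Longrightarrow> dist y z < e \<Longrightarrow> dist (\<delta> y) (\<delta> z) < \<delta> z / 2"
      using cont zW pos[OF zW] unfolding continuous_on_iff by (metis half_gt_zero)
    define s where "s = min r e"
    have ball_pos: "0 < emeasure lborel (ball z s)"
      using content_ball_pos[of s z] r(1) e(1)
      by (auto simp: s_def measure_def zero_less_iff_neq_zero)
    have "0 < ennreal (\<delta> z / 2) * emeasure lborel (ball z s)"
      using pos[OF zW] ball_pos by (simp add: ennreal_zero_less_mult_iff)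
    also have "\<dots> = (\<integral>\<^sup>+y. ennreal (\<delta> z / 2) * indicator (ball z s) y \<partial>lborel)"
      by (subst nn_integral_cmult_indicator) auto
    also have "\<dots> \<le> (\<integral>\<^sup>+y. \<delta> y * indicator (\<phi> ` B) y \<partial>lborel)"
    proof (rule nn_integral_mono)
      fix y
      show "ennreal (\<delta> z / 2) * indicator (ball z s) y \<le> ennreal (\<delta> y * indicator (\<phi> ` B) y)"
      proof (cases "y \<in> ball z s")
        case True
        then have "y \<in> ball z r" and y2: "dist y z < e" by (auto simp: s_def dist_commute)
        then have y: "y \<in> \<phi> ` B" "dist y z < e" using r(2) Q(3) by blast+
        then have "dist (\<delta> y) (\<delta> z) < \<delta> z / 2" using BW e(2) by blast
        then have "\<delta> z / 2 \<le> \<delta> y" unfolding dist_real_def by linarith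
        then show ?thesis using True y by (auto intro!: ennreal_leI)
      qed simp
    qed
    also have "\<dots> = emeasure m B" by (rule m[symmetric]) (use B in auto)
    also have "\<dots> \<le> emeasure m V" by (rule emeasure_mono) (use V sets_m in \<open>auto simp: B_def\<close>)
    finally show ?thesis .
  qed
qed

text \<open>In dimension 0 the volume is the counting measure on a finite space, all of whose subsets are Borel.\<close>

lemma compact_riemannian_manifold_volume:
  assumes "compact_riemannian_manifold A g m"
  shows "sets m = sets borel" "finite_measure m" "\<And>V. open V \<Longrightarrow> V \<noteq> {} \<Longrightarrow> 0 < emeasure m V"
proof -
  have M: "compact (UNIV :: 'a set)" using assms by (simp add: compact_riemannian_manifold_def)
  consider (pos) "smooth_atlas A" "riemannian_metric A g" "riemannian_volume A g m"
    | (zero) "finite (UNIV :: 'a set)" "m = count_space UNIV"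
    using assms by (auto simp: compact_riemannian_manifold_def)
  then have "sets m = sets borel \<and> finite_measure m \<and> (\<forall>V. open V \<longrightarrow> V \<noteq> {} \<longrightarrow> 0 < emeasure m V)"
  proof cases
    case pos
    have s: "sets m = sets borel" using pos by (simp add: riemannian_volume_def)
    show ?thesis
      using s riemannian_volume_locally_finite[OF pos] riemannian_volume_open_pos[OF pos]
        compact_UNIV_finite_measure_if_locally_finite[OF M s] by blast
  next
    case zero
    have "S \<in> sets borel" for S :: "'a set"
      using zero by (intro borel_closed finite_imp_closed) (auto intro: finite_subset)
    then have "sets (borel :: 'a measure) = UNIV" by blast
    then show ?thesis using zero
      by (auto simp: emeasure_count_space intro!: finite_measure_count_space)
  qed
  then show "sets m = sets borel" "finite_measure m" "\<And>V. open V \<Longrightarrow> V \<noteq> {} \<Longrightarrow> 0 < emeasure m V"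
    by auto
qed

section \<open>Borel probabilities and weak* convergence\<close>

lemma continuous_on_compact_UNIV_bounded:
  fixes \<phi> :: "'a::topological_space \<Rightarrow> 'b::real_normed_vector"
  assumes "compact (UNIV :: 'a set)" "continuous_on UNIV \<phi>"
  obtains C where "\<And>x. norm (\<phi> x) \<le> C"
  using compact_imp_bounded[OF compact_continuous_image[OF assms(2,1)]]
  unfolding bounded_iff by blast

lemma borel_probs_space: "\<mu> \<in> borel_probs \<Longrightarrow> space \<mu> = UNIV"
  by (metis (mono_tags, lifting) borel_probs_def mem_Collect_eq sets_eq_imp_space_eq space_borel)

lemma borel_probs_measurable:
  assumes "\<mu> \<in> borel_probs" "\<phi> \<in> borel_measurable borel"
  shows "\<phi> \<in> borel_measurable \<mu>"
  using assms by (simp add: borel_probs_def cong: measurable_cong_sets)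

lemma borel_probs_integrable:
  fixes \<phi> :: "'a::topological_space \<Rightarrow> 'b::{banach, second_countable_topology}"
  assumes "\<mu> \<in> borel_probs" "\<phi> \<in> borel_measurable borel" "\<And>x. norm (\<phi> x) \<le> C"
  shows "integrable \<mu> \<phi>"
proof -
  interpret prob_space \<mu> using assms(1) by (simp add: borel_probs_def)
  show ?thesis
    by (rule integrable_const_bound[of _ C]) (use assms in \<open>auto intro: borel_probs_measurable\<close>)
qed

lemma norm_integral_le_borel_probs:
  fixes \<phi> :: "'a::topological_space \<Rightarrow> complex"
  assumes "\<mu> \<in> borel_probs" "\<And>x. norm (\<phi> x) \<le> C"
  shows "norm (\<integral>x. \<phi> x \<partial>\<mu>) \<le> C"
proof (cases "integrable \<mu> \<phi>")
  case True
  interpret prob_space \<mu> using assms(1) by (simp add: borel_probs_def)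
  have "norm (\<integral>x. \<phi> x \<partial>\<mu>) \<le> (\<integral>x. norm (\<phi> x) \<partial>\<mu>)" by (rule integral_norm_bound)
  also have "\<dots> \<le> C" using True assms(2) by (intro integral_le_const) auto
  finally show ?thesis .
next
  case False
  then show ?thesis using order_trans[OF norm_ge_zero assms(2)] by (simp add: not_integrable_integral_eq)
qed

lemma bind_borel_probs:
  assumes N: "N \<in> measurable M (subprob_algebra borel)"
    and M: "prob_space M" and Nx: "\<And>x. N x \<in> borel_probs"
  shows "M \<bind> N \<in> borel_probs"
proof -
  have "N \<in> measurable M (prob_algebra borel)"
    by (rule measurable_prob_algebraI[OF _ N]) (use Nx in \<open>simp add: borel_probs_def\<close>)
  then show ?thesis
    using prob_space_bind'[of M M N borel] sets_bind'[of M M N borel] M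
    by (simp add: borel_probs_def space_prob_algebra)
qed

lemma integral_kernel_measurable:
  fixes \<phi> :: "'a::topological_space \<Rightarrow> complex"
  assumes \<phi>: "\<phi> \<in> borel_measurable borel" "\<And>x. norm (\<phi> x) \<le> C"
    and N [measurable]: "N \<in> measurable M (subprob_algebra borel)"
    and Nx: "\<And>x. N x \<in> borel_probs"
  shows "(\<lambda>x. \<integral>y. \<phi> y \<partial>N x) \<in> borel_measurable M"
proof -
  have [measurable]: "(\<lambda>x. \<integral>y. Re (\<phi> y) \<partial>N x) \<in> borel_measurable M"
    "(\<lambda>x. \<integral>y. Im (\<phi> y) \<partial>N x) \<in> borel_measurable M"
    using \<phi>(1) by (auto intro!: measurable_compose[OF N] integral_measurable_subprob_algebra)
  have eq: "(\<integral>y. \<phi> y \<partial>N x) = Complex (\<integral>y. Re (\<phi> y) \<partial>N x) (\<integral>y. Im (\<phi> y) \<partial>N x)" for x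
    by (rule complex_eqI) (simp_all add: borel_probs_integrable[OF Nx \<phi>])
  show ?thesis unfolding eq Complex_eq by measurable
qed

text \<open>The Fubini property of composition with a kernel, extended from real to complex integrands by treating
  the real and imaginary parts separately.\<close>

lemma integral_bind_complex:
  fixes \<phi> :: "'a::topological_space \<Rightarrow> complex"
  assumes \<phi>: "\<phi> \<in> borel_measurable borel" "\<And>x. norm (\<phi> x) \<le> C"
    and N: "N \<in> measurable M (subprob_algebra borel)"
    and M: "prob_space M" and Nx: "\<And>x. N x \<in> borel_probs"
  shows "(\<integral>x. \<phi> x \<partial>(M \<bind> N)) = (\<integral>x. (\<integral>y. \<phi> y \<partial>N x) \<partial>M)"
proof -
  interpret M: prob_space M by fact
  have Re: "(\<lambda>x. Re (\<phi> x)) \<in> borel_measurable borel" "\<bar>Re (\<phi> x)\<bar> \<le> C"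
    and Im: "(\<lambda>x. Im (\<phi> x)) \<in> borel_measurable borel" "\<bar>Im (\<phi> x)\<bar> \<le> C" for x
    using \<phi> abs_Re_le_cmod[of "\<phi> x"] abs_Im_le_cmod[of "\<phi> x"] by (auto intro: order_trans)
  have fin: "AE x in M. emeasure (N x) (space (N x)) \<le> ennreal 1"
    using Nx by (simp add: borel_probs_def prob_space.emeasure_space_1)
  note int = borel_probs_integrable[OF bind_borel_probs[OF N M Nx] \<phi>]
    borel_probs_integrable[OF Nx \<phi>]
  have int2: "integrable M (\<lambda>x. \<integral>y. \<phi> y \<partial>N x)"
    by (rule M.integrable_const_bound[of _ C])
      (use norm_integral_le_borel_probs[OF Nx \<phi>(2)] integral_kernel_measurable[OF \<phi> N Nx] in auto)
  show ?thesis
    using integral_bind[OF Re N M.finite_measure_axioms fin]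
      integral_bind[OF Im N M.finite_measure_axioms fin]
    by (intro complex_eqI) (simp_all add: int int2 flip: integral_Re integral_Im)
qed

lemma topspace_weak_star: "topspace weak_star = borel_probs"
proof
  have "{\<nu> \<in> borel_probs. integral\<^sup>L \<nu> (\<lambda>_. 0 :: complex) \<in> UNIV} \<subseteq> topspace weak_star"
    unfolding weak_star_def topology_generated_by_topspace
    by (rule Union_upper, rule CollectI, rule exI[of _ "\<lambda>_. 0"], rule exI[of _ UNIV]) simp
  then show "borel_probs \<subseteq> topspace weak_star" by simp
  show "topspace weak_star \<subseteq> borel_probs"
    unfolding weak_star_def topology_generated_by_topspace by (rule Union_least) blast
qed

text \<open>The topology is generated by the preimages of open sets under \<open>\<nu> \<mapsto> \<integral>\<phi> \<partial>\<nu>\<close>, so convergence means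
  convergence of these integrals. Membership in \<open>borel_probs\<close> is only eventual, because an
  average of length 0 is not a probability.\<close>

lemma limitin_weak_star:
  fixes \<nu> :: "'i \<Rightarrow> 'a::topological_space measure"
  shows "limitin weak_star \<nu> \<mu> F \<longleftrightarrow>
    \<mu> \<in> borel_probs \<and> (\<forall>\<^sub>F i in F. \<nu> i \<in> borel_probs) \<and>
    (\<forall>\<phi> :: 'a \<Rightarrow> complex. continuous_on UNIV \<phi> \<longrightarrow> ((\<lambda>i. \<integral>x. \<phi> x \<partial>\<nu> i) \<longlongrightarrow> (\<integral>x. \<phi> x \<partial>\<mu>)) F)"
    (is "?L \<longleftrightarrow> ?R")
proof
  assume L: ?L
  have \<mu>: "\<mu> \<in> borel_probs" using L by (simp add: limitin_def topspace_weak_star)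
  have ev: "\<forall>\<^sub>F i in F. \<nu> i \<in> U" if "openin weak_star U" "\<mu> \<in> U" for U
    using L that by (simp add: limitin_def)
  have "\<forall>\<^sub>F i in F. \<nu> i \<in> borel_probs"
    using ev[OF openin_topspace] \<mu> by (simp add: topspace_weak_star)
  moreover have "((\<lambda>i. \<integral>x. \<phi> x \<partial>\<nu> i) \<longlongrightarrow> (\<integral>x. \<phi> x \<partial>\<mu>)) F"
    if "continuous_on UNIV \<phi>" for \<phi> :: "'a \<Rightarrow> complex"
  proof (rule topological_tendstoI)
    fix W assume W: "open W" "integral\<^sup>L \<mu> \<phi> \<in> W"
    have "\<forall>\<^sub>F i in F. \<nu> i \<in> {\<nu> \<in> borel_probs. integral\<^sup>L \<nu> \<phi> \<in> W}"
    proof (rule ev)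
      show "openin weak_star {\<nu> \<in> borel_probs. integral\<^sup>L \<nu> \<phi> \<in> W}"
        unfolding weak_star_def using W that by (intro topology_generated_by_Basis) blast
    qed (use W \<mu> in auto)
    then show "\<forall>\<^sub>F i in F. integral\<^sup>L (\<nu> i) \<phi> \<in> W"
      by (rule eventually_mono) auto
  qed
  ultimately show ?R using \<mu> by blast
next
  assume R: ?R
  have "\<forall>\<^sub>F i in F. \<nu> i \<in> U" if "openin weak_star U" "\<mu> \<in> U" for U
    using openin_topology_generated_by[OF that(1)[unfolded weak_star_def]] that(2)
  proof induction
    case (UN K)
    then obtain k where "k \<in> K" "\<mu> \<in> k" by auto
    with UN have "\<forall>\<^sub>F i in F. \<nu> i \<in> k" by auto
    then show ?case by (rule eventually_mono) (use \<open>k \<in> K\<close> in auto)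
  next
    case (Basis s)
    then obtain \<phi> :: "'a \<Rightarrow> complex" and W where s: "s = {\<nu> \<in> borel_probs. integral\<^sup>L \<nu> \<phi> \<in> W}"
      "continuous_on UNIV \<phi>" "open W" by auto
    then have "((\<lambda>i. integral\<^sup>L (\<nu> i) \<phi>) \<longlongrightarrow> integral\<^sup>L \<mu> \<phi>) F" "integral\<^sup>L \<mu> \<phi> \<in> W"
      using R Basis.prems by auto
    then have "\<forall>\<^sub>F i in F. integral\<^sup>L (\<nu> i) \<phi> \<in> W"
      using topological_tendstoD[OF _ s(3)] by blast
    then show ?case using R by (simp add: s(1) eventually_conj_iff)
  qed (auto simp: eventually_conj_iff)
  then show ?L using R by (simp add: limitin_def topspace_weak_star)
qed

lemma pmf_kernel_measurable:
  assumes "\<And>j. \<nu> j \<in> borel_probs"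
  shows "\<nu> \<in> measurable (measure_pmf p) (subprob_algebra borel)"
  unfolding measurable_pmf_measure1
proof
  fix j show "\<nu> j \<in> space (subprob_algebra borel)"
    using assms[of j] unfolding space_subprob_algebra borel_probs_def
    by (simp add: prob_space_imp_subprob_space)
qed

text \<open>An average of measures is the law of a point drawn from \<open>\<nu> j\<close> with \<open>j\<close> uniform on \<open>{1..n}\<close>. This
  gives its integrals and also the countable additivity that \<open>measure_of\<close> needs.\<close>

lemma average_measure_eq_bind:
  assumes n: "n \<ge> 1" and \<nu>: "\<And>j. \<nu> j \<in> borel_probs"
  shows "average_measure \<nu> n = measure_pmf (pmf_of_set {1..n}) \<bind> \<nu>"
proof -
  let ?B = "measure_pmf (pmf_of_set {1..n}) \<bind> \<nu>"
  note N = pmf_kernel_measurable[OF \<nu>]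
  have B: "?B \<in> borel_probs"
    by (rule bind_borel_probs[OF N measure_pmf.prob_space_axioms \<nu>])
  have "emeasure ?B S = (\<Sum>j = 1..n. emeasure (\<nu> j) S) / of_nat n" if S: "S \<in> sets borel" for S
  proof -
    have "emeasure ?B S = (\<integral>\<^sup>+j. emeasure (\<nu> j) S \<partial>measure_pmf (pmf_of_set {1..n}))"
      by (rule emeasure_bind[OF _ N S]) simp
    also have "\<dots> = (\<Sum>j = 1..n. emeasure (\<nu> j) S) / of_nat n"
      using n by (subst nn_integral_pmf_of_set) auto
    finally show ?thesis .
  qed
  then have "average_measure \<nu> n = measure_of UNIV (sets borel) (emeasure ?B)"
    unfolding average_measure_def
    by (intro measure_of_eq) (metis sets.space_closed space_borel, metis sets.sigma_sets_eq space_borel)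
  also have "\<dots> = ?B"
    using measure_of_of_measure[of ?B] B borel_probs_space[OF B] by (simp add: borel_probs_def)
  finally show ?thesis .
qed

lemma average_measure_borel_probs:
  assumes n: "n \<ge> 1" and \<nu>: "\<And>j. \<nu> j \<in> borel_probs"
  shows "average_measure \<nu> n \<in> borel_probs"
  unfolding average_measure_eq_bind[OF assms]
  by (rule bind_borel_probs[OF pmf_kernel_measurable[OF \<nu>] measure_pmf.prob_space_axioms \<nu>])

lemma integral_average_measure:
  fixes \<phi> :: "'a::topological_space \<Rightarrow> complex"
  assumes n: "n \<ge> 1" and \<nu>: "\<And>j. \<nu> j \<in> borel_probs"
    and \<phi>: "\<phi> \<in> borel_measurable borel" "\<And>x. norm (\<phi> x) \<le> C"
  shows "(\<integral>x. \<phi> x \<partial>average_measure \<nu> n) = (\<Sum>j = 1..n. \<integral>x. \<phi> x \<partial>\<nu> j) / of_nat n"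
proof -
  have "(\<integral>x. \<phi> x \<partial>average_measure \<nu> n) = (\<integral>j. (\<integral>x. \<phi> x \<partial>\<nu> j) \<partial>measure_pmf (pmf_of_set {1..n}))"
    unfolding average_measure_eq_bind[OF n \<nu>]
    by (rule integral_bind_complex[OF \<phi> pmf_kernel_measurable[OF \<nu>] measure_pmf.prob_space_axioms \<nu>])
  also have "\<dots> = (\<Sum>j = 1..n. \<integral>x. \<phi> x \<partial>\<nu> j) / of_nat n"
    using n by (subst integral_measure_pmf[of "{1..n}"])
      (auto simp: scaleR_conv_of_real sum_divide_distrib)
  finally show ?thesis .
qed

section \<open>Sequential compactness of the space of probabilities\<close>

text \<open>The terms after the first nonzero one sum to at most half of it, since
  \<open>\<Sum>k>n. 3\<^sup>-\<^sup>k = 3\<^sup>-\<^sup>n / 2\<close>.\<close>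

lemma ternary_series_apart:
  fixes c :: "nat \<Rightarrow> real"
  assumes bound: "\<And>k. \<bar>c k\<bar> \<le> 1" and zero: "\<And>k. k < n \<Longrightarrow> c k = 0" and one: "\<bar>c n\<bar> = 1"
  shows "(1 / 3) ^ n / 2 \<le> \<bar>\<Sum>k. c k * (1 / 3) ^ k\<bar>"
proof -
  have geo: "summable (\<lambda>k. (1 / 3 :: real) ^ k)" by (rule summable_geometric) simp
  have le: "norm (c k * (1 / 3) ^ k) \<le> (1 / 3) ^ k" for k
    using bound[of k] by (simp add: abs_mult power_abs mult_left_le_one_le)
  have summ: "summable (\<lambda>k. c k * (1 / 3) ^ k)"
    by (rule summable_comparison_test[OF _ geo]) (use le in blast)
  define T where "T = (\<Sum>k. c (k + Suc n) * (1 / 3) ^ (k + Suc n))"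
  have "(\<Sum>k. c k * (1 / 3) ^ k) = T + (\<Sum>k<Suc n. c k * (1 / 3) ^ k)"
    unfolding T_def by (rule suminf_split_initial_segment[OF summ])
  also have "(\<Sum>k<Suc n. c k * (1 / 3) ^ k) = c n * (1 / 3) ^ n" using zero by simp
  finally have split: "(\<Sum>k. c k * (1 / 3) ^ k) = T + c n * (1 / 3) ^ n" .
  have sT: "(\<lambda>k. (1 / 3 :: real) ^ (k + Suc n)) sums ((1 / 3) ^ n / 2)"
  proof -
    have "(\<lambda>k. (1 / 3 :: real) ^ Suc n * (1 / 3) ^ k) sums ((1 / 3) ^ Suc n * (1 / (1 - 1 / 3)))"
      by (intro sums_mult geometric_sums) simp
    then show ?thesis by (simp add: power_add mult_ac)
  qed
  have "norm T \<le> (\<Sum>k. (1 / 3) ^ (k + Suc n))"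
    unfolding T_def by (rule norm_suminf_le[OF le sums_summable[OF sT]])
  also have "\<dots> = (1 / 3) ^ n / 2" using sT by (simp add: sums_iff)
  finally have "\<bar>T\<bar> \<le> (1 / 3) ^ n / 2" by simp
  moreover have "\<bar>c n * (1 / 3) ^ n\<bar> = (1 / 3) ^ n" using one by (simp add: abs_mult)
  ultimately show ?thesis unfolding split by linarith
qed

text \<open>The real number \<open>h x\<close> records, in ternary digits 0 and 1, to which members of a countable family of
  balls \<open>x\<close> belongs. The family contains for every radius a finite cover of the space. If \<open>h x\<close> and \<open>h y\<close> are very
  close, then their first digits agree, so some small ball contains both \<open>x\<close> and \<open>y\<close>.\<close>

lemma compact_metric_real_code:
  assumes comp: "compact (UNIV :: 'a::metric_space set)"
  obtains h :: "'a::metric_space \<Rightarrow> real" where "h \<in> borel_measurable borel" "\<And>x. 0 \<le> h x \<and> h x \<le> 3 / 2"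
    "\<forall>e>0. \<exists>\<delta>>0. \<forall>x y. \<bar>h x - h y\<bar> < \<delta> \<longrightarrow> dist x y < e"
proof -
  have "\<exists>F. finite F \<and> (UNIV :: 'a set) \<subseteq> (\<Union>p\<in>F. ball p (1 / Suc k))" for k :: nat
    using comp unfolding compact_eq_totally_bounded
    by (meson of_nat_0_less_iff zero_less_Suc zero_less_divide_1_iff)
  then have "\<exists>F. \<forall>k. finite (F k) \<and> (UNIV :: 'a set) \<subseteq> (\<Union>p\<in>F k. ball p (1 / Suc k))"
    by (intro choice allI)
  then obtain F where F: "\<And>k. finite (F k)" "\<And>k. (UNIV :: 'a set) \<subseteq> (\<Union>p\<in>F k. ball p (1 / Suc k))"
    by blast
  define \<B> where "\<B> = (\<Union>k. (\<lambda>p. ball p (1 / Suc k)) ` F k)"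
  define B where "B = from_nat_into \<B>"
  have count: "countable \<B>" unfolding \<B>_def using F(1) by (intro countable_UN countableI_type countable_image countable_finite)
  have "F 0 \<noteq> {}" using F(2)[of 0] by auto
  then have ne: "\<B> \<noteq> {}" unfolding \<B>_def by auto
  have B_open: "open (B n)" for n
    using from_nat_into[OF ne, of n] by (auto simp: B_def \<B>_def)
  define h :: "'a \<Rightarrow> real" where "h x = (\<Sum>n. indicator (B n) x * (1 / 3) ^ n)" for x
  have geo: "(\<lambda>k. (1 / 3 :: real) ^ k) sums (3 / 2)"
    using geometric_sums[of "1 / 3 :: real"] by simp
  have summ: "summable (\<lambda>n. indicator (B n) x * (1 / 3 :: real) ^ n)" for x
    by (rule summable_comparison_test[OF _ sums_summable[OF geo]])
      (auto intro!: exI[of _ 0] simp: indicator_def)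
  show thesis
  proof
    have [measurable]: "B n \<in> sets borel" for n using B_open by auto
    show "h \<in> borel_measurable borel" unfolding h_def by measurable
    show "0 \<le> h x \<and> h x \<le> 3 / 2" for x
    proof
      show "0 \<le> h x" unfolding h_def by (rule suminf_nonneg[OF summ]) simp
      have "h x \<le> (\<Sum>n. (1 / 3) ^ n)" unfolding h_def
        by (rule suminf_le[OF _ summ sums_summable[OF geo]]) (simp add: indicator_def)
      then show "h x \<le> 3 / 2" using geo by (simp add: sums_iff)
    qed
    show "\<forall>e>0. \<exists>\<delta>>0. \<forall>x y. \<bar>h x - h y\<bar> < \<delta> \<longrightarrow> dist x y < e"
    proof (intro allI impI)
      fix e :: real assume "0 < e"
      then obtain k where k: "1 / real (Suc k) < e / 2" using nat_approx_posE[of "e / 2"] by auto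
      have "\<forall>p\<in>F k. \<exists>n. B n = ball p (1 / Suc k)"
        using from_nat_into_surj[OF count] unfolding B_def \<B>_def by blast
      then obtain idx where idx: "\<And>p. p \<in> F k \<Longrightarrow> B (idx p) = ball p (1 / Suc k)" by metis
      define N where "N = Max (idx ` F k)"
      have idx_le: "idx p \<le> N" if "p \<in> F k" for p using that F(1) by (simp add: N_def)
      have "dist x y < e" if xy: "\<bar>h x - h y\<bar> < (1 / 3) ^ N / 2" for x y
      proof -
        have agree: "x \<in> B n \<longleftrightarrow> y \<in> B n" if "n \<le> N" for n
        proof (rule ccontr)
          assume n: "\<not> (x \<in> B n \<longleftrightarrow> y \<in> B n)"
          define j where "j = (LEAST n. \<not> (x \<in> B n \<longleftrightarrow> y \<in> B n))"
          have j: "\<not> (x \<in> B j \<longleftrightarrow> y \<in> B j)" "j \<le> n" "\<And>i. i < j \<Longrightarrow> x \<in> B i \<longleftrightarrow> y \<in> B i"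
            unfolding j_def using LeastI[of "\<lambda>n. \<not> (x \<in> B n \<longleftrightarrow> y \<in> B n)", OF n]
              Least_le[of "\<lambda>n. \<not> (x \<in> B n \<longleftrightarrow> y \<in> B n)", OF n]
              not_less_Least[of _ "\<lambda>n. \<not> (x \<in> B n \<longleftrightarrow> y \<in> B n)"] by blast+
          define c :: "nat \<Rightarrow> real" where "c i = indicator (B i) x - indicator (B i) y" for i
          have "(1 / 3) ^ j / 2 \<le> \<bar>\<Sum>i. c i * (1 / 3) ^ i\<bar>"
            by (rule ternary_series_apart) (use j in \<open>auto simp: c_def indicator_def\<close>)
          also have "(\<Sum>i. c i * (1 / 3) ^ i) = h x - h y"
            unfolding h_def c_def left_diff_distrib by (rule suminf_diff[OF summ summ, symmetric])
          also note xy
          finally have "(1 / 3) ^ j / 2 < ((1 / 3) ^ N / 2 :: real)" .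
          moreover have "(1 / 3 :: real) ^ N \<le> (1 / 3) ^ j"
            by (rule power_decreasing) (use j(2) that in auto)
          ultimately show False by simp
        qed
        obtain p where p: "p \<in> F k" "x \<in> ball p (1 / Suc k)" using F(2)[of k] by blast
        then have "y \<in> ball p (1 / Suc k)" using agree[OF idx_le[OF p(1)]] idx[OF p(1)] by simp
        with p k show ?thesis using dist_triangle2[of x y p] by (simp add: dist_commute)
      qed
      then show "\<exists>\<delta>>0. \<forall>x y. \<bar>h x - h y\<bar> < \<delta> \<longrightarrow> dist x y < e"
        by (intro exI[of _ "(1 / 3) ^ N / 2"]) simp
    qed
  qed
qed

text \<open>The decoding map sends \<open>y\<close> to the limit of a convergent sequence \<open>X\<close> with \<open>h (X i) \<rightarrow> y\<close>, which exists
  by compactness. Different choices of \<open>X\<close> do not matter, because points with nearby codes are near each other.\<close>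

lemma compact_metric_decode:
  fixes h :: "'a::metric_space \<Rightarrow> real"
  assumes comp: "compact (UNIV :: 'a set)"
    and h: "\<forall>e>0. \<exists>\<delta>>0. \<forall>x y. \<bar>h x - h y\<bar> < \<delta> \<longrightarrow> dist x y < e"
  shows "\<exists>g. continuous_on (closure (range h)) g \<and> (\<forall>x. g (h x) = x)"
proof -
  have "\<exists>x X. (\<lambda>i. h (X i)) \<longlonglongrightarrow> y \<and> X \<longlonglongrightarrow> x" if "y \<in> closure (range h)" for y
  proof -
    have "\<exists>Y. (\<forall>i. Y i \<in> range h) \<and> Y \<longlonglongrightarrow> y" using that by (simp only: closure_sequential)
    then obtain Y where Y': "(\<forall>i. Y i \<in> range h) \<and> Y \<longlonglongrightarrow> y" by (rule exE)
    then have Y: "Y \<longlonglongrightarrow> y" by simp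
    define X where "X i = inv h (Y i)" for i
    have X: "h (X i) = Y i" for i using Y' by (simp add: X_def f_inv_into_f)
    obtain x r where r: "strict_mono r" "(X \<circ> r) \<longlonglongrightarrow> x"
      using comp unfolding compact_def by (meson UNIV_I)
    have "(\<lambda>i. h ((X \<circ> r) i)) \<longlonglongrightarrow> y" using LIMSEQ_subseq_LIMSEQ[OF Y r(1)] by (simp add: o_def X)
    then show ?thesis using r(2) by blast
  qed
  then have "\<forall>y. \<exists>x. y \<in> closure (range h) \<longrightarrow> (\<exists>X. (\<lambda>i. h (X i)) \<longlonglongrightarrow> y \<and> X \<longlonglongrightarrow> x)" by blast
  then have "\<exists>g. \<forall>y. y \<in> closure (range h) \<longrightarrow> (\<exists>X. (\<lambda>i. h (X i)) \<longlonglongrightarrow> y \<and> X \<longlonglongrightarrow> g y)"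
    by (rule choice)
  then obtain g where g: "\<forall>y. y \<in> closure (range h) \<longrightarrow> (\<exists>X. (\<lambda>i. h (X i)) \<longlonglongrightarrow> y \<and> X \<longlonglongrightarrow> g y)"
    by (rule exE)
  have near: "\<exists>\<delta>>0. \<forall>y\<in>closure (range h). \<forall>x. \<bar>y - h x\<bar> < \<delta> \<longrightarrow> dist (g y) x \<le> e" if e: "0 < e" for e
  proof -
    obtain \<delta> where \<delta>: "\<delta> > 0" "\<And>x y. \<bar>h x - h y\<bar> < \<delta> \<Longrightarrow> dist x y < e" using h e by blast
    have "dist (g y) x \<le> e" if y: "y \<in> closure (range h)" and x: "\<bar>y - h x\<bar> < \<delta>" for x y
    proof -
      obtain X where X: "(\<lambda>i. h (X i)) \<longlonglongrightarrow> y" "X \<longlonglongrightarrow> g y" using g y by blast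
      have "(\<lambda>i. \<bar>h (X i) - h x\<bar>) \<longlonglongrightarrow> \<bar>y - h x\<bar>" by (intro tendsto_intros X)
      then have "\<forall>\<^sub>F i in sequentially. \<bar>h (X i) - h x\<bar> < \<delta>" using x by (rule order_tendstoD)
      then have "\<forall>\<^sub>F i in sequentially. dist (X i) x \<le> e"
        by eventually_elim (rule less_imp_le[OF \<delta>(2)])
      moreover have "(\<lambda>i. dist (X i) x) \<longlonglongrightarrow> dist (g y) x" by (intro tendsto_intros X)
      ultimately show ?thesis by (intro tendsto_upperbound) auto
    qed
    then show ?thesis using \<delta>(1) by blast
  qed
  show ?thesis
  proof (intro exI[of _ g] conjI allI)
    show "g (h x) = x" for x
    proof -
      have hx: "h x \<in> closure (range h)" using closure_subset[of "range h"] by blast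
      have "dist (g (h x)) x \<le> e" if e: "0 < e" for e
      proof -
        obtain \<delta> where "\<delta> > 0"
          and \<delta>: "\<forall>y\<in>closure (range h). \<forall>x. \<bar>y - h x\<bar> < \<delta> \<longrightarrow> dist (g y) x \<le> e"
          using near[OF e] by blast
        have "\<bar>h x - h x\<bar> < \<delta> \<longrightarrow> dist (g (h x)) x \<le> e" by (rule bspec[OF \<delta> hx, THEN spec])
        then show ?thesis using \<open>\<delta> > 0\<close> by simp
      qed
      then have "dist (g (h x)) x \<le> 0" by (rule field_le_epsilon) simp
      then show ?thesis by simp
    qed
    show "continuous_on (closure (range h)) g"
      unfolding continuous_on_iff
    proof (intro ballI allI impI)
      fix y and e :: real assume y: "y \<in> closure (range h)" and "0 < e"
      then have "0 < e / 3" by simp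
      from near[OF this] obtain \<delta> where \<delta>: "\<delta> > 0"
        "\<forall>y\<in>closure (range h). \<forall>x. \<bar>y - h x\<bar> < \<delta> \<longrightarrow> dist (g y) x \<le> e / 3" by blast
      have "dist (g y') (g y) < e" if y': "y' \<in> closure (range h)" "dist y' y < \<delta> / 2" for y'
      proof -
        have "\<exists>z\<in>range h. dist z y < \<delta> / 2"
          using y half_gt_zero[OF \<delta>(1)] unfolding closure_approachable by blast
        then obtain x where x: "\<bar>h x - y\<bar> < \<delta> / 2" unfolding dist_real_def by blast
        have "\<bar>y - h x\<bar> < \<delta>" "\<bar>y' - h x\<bar> < \<delta>" using x y'(2) \<delta>(1) unfolding dist_real_def by linarith+
        then have "dist (g y) x \<le> e / 3" "dist (g y') x \<le> e / 3" using \<delta>(2) y y'(1) by blast+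
        then show ?thesis using dist_triangle2[of "g y'" "g y" x] \<open>0 < e\<close> by linarith
      qed
      then show "\<exists>\<delta>>0. \<forall>y'\<in>closure (range h). dist y' y < \<delta> \<longrightarrow> dist (g y') (g y) < e"
        using \<delta>(1) by (intro exI[of _ "\<delta> / 2"]) auto
    qed
  qed
qed

text \<open>The truncated distance from \<open>K\<close> is a bounded continuous function whose integrals against \<open>\<nu> i\<close> vanish,
  hence also its integral against \<open>N\<close>.\<close>

lemma weak_conv_limit_in_closed:
  assumes \<nu>: "\<And>i. real_distribution (\<nu> i)" and N: "real_distribution N" and conv: "weak_conv_m \<nu> N"
    and K: "closed K" "K \<noteq> {}" "\<And>i. AE y in \<nu> i. y \<in> K"
  shows "AE y in N. y \<in> K"
proof -
  interpret N: real_distribution N by fact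
  define \<psi> :: "real \<Rightarrow> real" where "\<psi> y = min 1 (infdist y K)" for y
  have cont: "continuous_on UNIV \<psi>" unfolding \<psi>_def by (intro continuous_intros)
  have \<psi>: "0 \<le> \<psi> y" "norm (\<psi> y) \<le> 1" for y by (auto simp: \<psi>_def infdist_nonneg)
  have "(\<lambda>i. integral\<^sup>L (\<nu> i) \<psi>) \<longlonglongrightarrow> integral\<^sup>L N \<psi>"
    by (rule weak_conv_imp_integral_bdd_continuous_conv[OF \<nu> N conv _ \<psi>(2)])
      (use cont in \<open>simp add: continuous_on_eq_continuous_at\<close>)
  moreover have "integral\<^sup>L (\<nu> i) \<psi> = 0" for i
  proof (rule integral_eq_zero_AE)
    show "AE y in \<nu> i. \<psi> y = 0" using K(3)[of i] by eventually_elim (simp add: \<psi>_def)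
  qed
  ultimately have "integral\<^sup>L N \<psi> = 0" by (simp add: LIMSEQ_const_iff)
  moreover have "integrable N \<psi>"
    by (rule N.integrable_const_bound[of _ 1]) (use \<psi> borel_measurable_continuous_onI[OF cont] in auto)
  ultimately have "AE y in N. \<psi> y = 0" using \<psi>(1) by (subst (asm) integral_nonneg_eq_0_iff_AE) auto
  then show ?thesis
  proof eventually_elim
    case (elim y)
    then have "infdist y K = 0" by (simp add: \<psi>_def min_def split: if_splits)
    then show ?case using in_closed_iff_infdist_zero[OF K(1,2)] by simp
  qed
qed

text \<open>The codes move the measures to a bounded interval, where Helly's selection theorem applies. The limit
  lives on the closure \<open>K\<close> of the set of codes and is moved back by the decoding map \<open>g\<close>. A test function
  \<open>\<phi>\<close> turns into \<open>\<phi> \<circ> g\<close> on \<open>K\<close>, which Tietze's theorem extends to a bounded continuous function on the line.\<close>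

lemma borel_probs_sequentially_compact:
  fixes \<nu> :: "nat \<Rightarrow> 'a::metric_space measure"
  assumes comp: "compact (UNIV :: 'a set)" and \<nu>: "\<And>i. \<nu> i \<in> borel_probs"
  obtains r \<mu> where "strict_mono r" "limitin weak_star (\<lambda>i. \<nu> (r i)) \<mu> sequentially"
proof -
  obtain h :: "'a \<Rightarrow> real" where h: "h \<in> borel_measurable borel" "\<And>x. 0 \<le> h x \<and> h x \<le> 3 / 2"
    "\<forall>e>0. \<exists>\<delta>>0. \<forall>x y. \<bar>h x - h y\<bar> < \<delta> \<longrightarrow> dist x y < e"
    using compact_metric_real_code[OF comp] by blast
  define K where "K = closure (range h)"
  have "\<exists>g. continuous_on K g \<and> (\<forall>x. g (h x) = x)"
    unfolding K_def by (rule compact_metric_decode[OF comp h(3)])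
  then obtain g where "continuous_on K g \<and> (\<forall>x. g (h x) = x)" by (rule exE)
  then have g: "continuous_on K g" "\<And>x. g (h x) = x" by simp_all
  have hK: "h x \<in> K" for x unfolding K_def using closure_subset[of "range h"] by blast
  have K: "closed K" "K \<noteq> {}" using hK by (auto simp: K_def)
  have h\<nu> [measurable]: "h \<in> borel_measurable (\<nu> i)" for i by (rule borel_probs_measurable[OF \<nu> h(1)])
  define \<nu>' where "\<nu>' i = distr (\<nu> i) borel h" for i
  have prob: "prob_space (\<nu> i)" for i using \<nu>[of i] by (simp add: borel_probs_def)
  have rd: "real_distribution (\<nu>' i)" for i
    unfolding \<nu>'_def by (rule prob_space.real_distribution_distr[OF prob h\<nu>])
  have meas: "measure (\<nu>' i) {-1<..2} = 1" for i
  proof -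
    have "measure (\<nu>' i) {-1<..2} = measure (\<nu> i) (h -` {-1<..2} \<inter> space (\<nu> i))"
      unfolding \<nu>'_def by (rule measure_distr) auto
    also have "h -` {-1<..2} = UNIV"
    proof -
      have "-1 < h x \<and> h x \<le> 2" for x using h(2)[of x] by linarith
      then show ?thesis by auto
    qed
    also have "measure (\<nu> i) (UNIV \<inter> space (\<nu> i)) = 1" using prob_space.prob_space[OF prob] by simp
    finally show ?thesis .
  qed
  have "tight \<nu>'"
    unfolding tight_def
  proof (intro conjI allI impI rd)
    fix e :: real assume "0 < e"
    then show "\<exists>a b. a < b \<and> (\<forall>i. 1 - e < measure (\<nu>' i) {a<..b})"
      using meas by (intro exI[of _ "-1"] exI[of _ 2]) simp
  qed
  then obtain r N where r: "strict_mono r" and N: "real_distribution N" and conv: "weak_conv_m (\<nu>' \<circ> id \<circ> r) N"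
    using tight_imp_convergent_subsubsequence[of \<nu>' id] by (auto simp: strict_mono_def)
  interpret N: real_distribution N by fact
  have conv': "weak_conv_m (\<lambda>i. \<nu>' (r i)) N" using conv by (simp add: o_def)
  have AE_K: "AE y in N. y \<in> K"
  proof (rule weak_conv_limit_in_closed[OF rd N conv' K])
    show "AE y in \<nu>' (r i). y \<in> K" for i
      unfolding \<nu>'_def using K(1) hK by (subst AE_distr_iff) auto
  qed
  define G where "G y = (if y \<in> K then g y else g 0)" for y
  have G [measurable]: "G \<in> borel_measurable borel"
    unfolding G_def using K(1) g(1) by (intro borel_measurable_continuous_on_if) auto
  define \<mu> where "\<mu> = distr N borel G"
  have \<mu>: "\<mu> \<in> borel_probs"
    unfolding \<mu>_def borel_probs_def by (auto intro!: N.prob_space_distr)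
  have "(\<lambda>i. \<integral>x. \<phi> x \<partial>\<nu> (r i)) \<longlonglongrightarrow> (\<integral>x. \<phi> x \<partial>\<mu>)" if \<phi>: "continuous_on UNIV \<phi>" for \<phi> :: "'a \<Rightarrow> complex"
  proof -
    obtain C where C: "\<And>x. norm (\<phi> x) \<le> C" using continuous_on_compact_UNIV_bounded[OF comp \<phi>] by blast
    have C0: "0 \<le> C" using order_trans[OF norm_ge_zero C] by blast
    have [measurable]: "\<phi> \<in> borel_measurable borel" by (rule borel_measurable_continuous_onI[OF \<phi>])
    have "continuous_on K (\<lambda>y. \<phi> (g y))" using continuous_on_compose2[OF \<phi> g(1)] by simp
    then obtain F where F: "continuous_on UNIV F" "\<And>y. y \<in> K \<Longrightarrow> F y = \<phi> (g y)" "\<And>y. norm (F y) \<le> C"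
      using Tietze[of K "\<lambda>y. \<phi> (g y)" UNIV C] K(1) C C0 by auto
    have [measurable]: "F \<in> borel_measurable borel" by (rule borel_measurable_continuous_onI[OF F(1)])
    have "(\<lambda>i. integral\<^sup>L (\<nu>' (r i)) F) \<longlonglongrightarrow> integral\<^sup>L N F"
      by (rule weak_conv_imp_integral_bdd_continuous_conv[OF rd N conv' _ F(3)])
        (use F(1) in \<open>simp add: continuous_on_eq_continuous_at\<close>)
    moreover have "integral\<^sup>L (\<nu>' i) F = (\<integral>x. \<phi> x \<partial>\<nu> i)" for i
      unfolding \<nu>'_def by (subst integral_distr) (simp_all add: F(2)[OF hK] g(2))
    moreover have "integral\<^sup>L N F = (\<integral>x. \<phi> x \<partial>\<mu>)"
    proof -
      have "(\<integral>x. \<phi> x \<partial>\<mu>) = (\<integral>y. \<phi> (G y) \<partial>N)" unfolding \<mu>_def by (subst integral_distr) auto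
      also have "\<dots> = integral\<^sup>L N F"
      proof (rule integral_cong_AE)
        show "AE y in N. \<phi> (G y) = F y" using AE_K by eventually_elim (simp add: G_def F(2))
      qed measurable
      finally show ?thesis ..
    qed
    ultimately show ?thesis by simp
  qed
  then have "limitin weak_star (\<lambda>i. \<nu> (r i)) \<mu> sequentially"
    unfolding limitin_weak_star using \<mu> \<nu> by auto
  with r show thesis by (rule that)
qed

section \<open>Passing from pointwise to uniform convergence on a set of positive measure\<close>

text \<open>Egorov's theorem: for each tolerance \<open>1 / (k + 1)\<close> the set of points that exceed it at some time after
  \<open>N\<close> shrinks to the empty set, so a late \<open>N k\<close> makes it smaller than \<open>2\<^sup>-\<^sup>k\<^sup>-\<^sup>2\<close> times the measure of
  \<open>S\<close>. Removing all these sets leaves at least half of \<open>S\<close>.\<close>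

lemma egorov_positive_set:
  fixes D :: "nat \<Rightarrow> 'a \<Rightarrow> real"
  assumes fin: "finite_measure M" and D: "\<And>n. D n \<in> borel_measurable M"
    and S: "S \<in> sets M" "0 < emeasure M S" and lim: "\<And>x. x \<in> S \<Longrightarrow> (\<lambda>n. D n x) \<longlonglongrightarrow> 0"
  obtains T where "T \<subseteq> S" "T \<in> sets M" "0 < emeasure M T"
    "\<And>\<rho>. 0 < \<rho> \<Longrightarrow> \<exists>N. \<forall>n\<ge>N. \<forall>x\<in>T. D n x < \<rho>"
proof -
  interpret finite_measure M by fact
  note [measurable] = D S(1)
  have SM: "S \<subseteq> space M" using S(1) by (rule sets.sets_into_space)
  define E where "E k N = {x \<in> space M. x \<in> S \<and> (\<exists>n\<ge>N. 1 / real (Suc k) \<le> D n x)}" for k N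
  have E_sets [measurable]: "E k N \<in> sets M" for k N unfolding E_def by measurable
  have "(\<lambda>N. measure M (E k N)) \<longlonglongrightarrow> 0" for k
  proof -
    have "decseq (E k)" unfolding E_def decseq_def by (auto intro: order_trans)
    then have "(\<lambda>N. measure M (E k N)) \<longlonglongrightarrow> measure M (\<Inter>N. E k N)"
      by (intro finite_Lim_measure_decseq) auto
    also have "(\<Inter>N. E k N) = {}"
    proof (rule ccontr)
      assume "(\<Inter>N. E k N) \<noteq> {}"
      then obtain x where x: "\<And>N. x \<in> E k N" by auto
      then have "\<forall>\<^sub>F n in sequentially. D n x < 1 / real (Suc k)"
        using lim[of x] by (intro order_tendstoD(2)[of _ 0]) (auto simp: E_def)
      then obtain N where "\<And>n. N \<le> n \<Longrightarrow> D n x < 1 / real (Suc k)" unfolding eventually_sequentially by blast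
      then show False using x[of N] unfolding E_def by (auto simp: not_le[symmetric])
    qed
    finally show ?thesis by simp
  qed
  moreover have pos: "0 < measure M S" using S(2) by (simp add: emeasure_eq_measure)
  ultimately have "\<forall>\<^sub>F N in sequentially. measure M (E k N) < measure M S / 2 * (1 / 2) ^ Suc k" for k
    by (intro order_tendstoD(2)[of _ 0]) auto
  then have "\<exists>N. measure M (E k N) < measure M S / 2 * (1 / 2) ^ Suc k" for k
    unfolding eventually_sequentially by blast
  then obtain N where N: "\<And>k. measure M (E k (N k)) < measure M S / 2 * (1 / 2) ^ Suc k" by metis
  define T where "T = S - (\<Union>k. E k (N k))"
  have geo: "(\<lambda>k. measure M S / 2 * (1 / 2) ^ Suc k) sums (measure M S / 2 * 1)"
    by (rule sums_mult[OF power_half_series])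
  have summ: "summable (\<lambda>k. measure M (E k (N k)))"
    by (rule summable_comparison_test[OF _ sums_summable[OF geo]]) (use N in \<open>auto intro!: exI[of _ 0] less_imp_le\<close>)
  have "measure M (\<Union>k. E k (N k)) \<le> (\<Sum>k. measure M (E k (N k)))"
    by (rule finite_measure_subadditive_countably[OF _ summ]) auto
  also have "\<dots> \<le> (\<Sum>k. measure M S / 2 * (1 / 2) ^ Suc k)"
    by (rule suminf_le[OF _ summ sums_summable[OF geo]]) (use N less_imp_le in blast)
  also have "\<dots> = measure M S / 2" using geo by (simp add: sums_iff)
  finally have bad: "measure M (\<Union>k. E k (N k)) \<le> measure M S / 2" .
  have "(\<Union>k. E k (N k)) \<subseteq> S" unfolding E_def by blast
  then have "measure M T = measure M S - measure M (\<Union>k. E k (N k))"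
    unfolding T_def by (intro finite_measure_Diff) auto
  with bad pos have T_pos: "0 < measure M T" by linarith
  show thesis
  proof
    show "T \<subseteq> S" unfolding T_def by blast
    show "T \<in> sets M" unfolding T_def by measurable
    show "0 < emeasure M T" using T_pos by (simp add: emeasure_eq_measure)
    fix \<rho> :: real assume "0 < \<rho>"
    then obtain k where k: "1 / real (Suc k) < \<rho>" using nat_approx_posE by blast
    have "D n x < \<rho>" if "N k \<le> n" "x \<in> T" for n x
    proof -
      have "x \<in> S" "x \<notin> E k (N k)" using that(2) unfolding T_def by blast+
      then have "D n x < 1 / real (Suc k)" using that(1) SM unfolding E_def by force
      with k show ?thesis by linarith
    qed
    then show "\<exists>N. \<forall>n\<ge>N. \<forall>x\<in>T. D n x < \<rho>" by blast
  qed
qed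

section \<open>Zero-noise limit of the empiric stochastic probabilities\<close>

text \<open>Metrizability is used twice: convergence is expressed by \<open>d\<close>, and limits are unique, so that a
  probability is determined by its integrals of continuous functions.\<close>

locale metrized_weak_star = Metric_space borel_probs d
  for d :: "'a::metric_space measure \<Rightarrow> 'a measure \<Rightarrow> real" +
  assumes mtopology_weak_star: "mtopology = weak_star"
    and compact_UNIV: "compact (UNIV :: 'a set)"
begin

lemma continuous_bounded_measurable:
  fixes \<phi> :: "'a \<Rightarrow> complex"
  assumes "continuous_on UNIV \<phi>"
  obtains C where "\<phi> \<in> borel_measurable borel" "\<And>x. norm (\<phi> x) \<le> C"
  using continuous_on_compact_UNIV_bounded[OF compact_UNIV assms]
    borel_measurable_continuous_onI[OF assms] by blast

lemma continuous_integrable: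
  fixes \<phi> :: "'a \<Rightarrow> complex"
  assumes "continuous_on UNIV \<phi>" "\<mu> \<in> borel_probs"
  shows "integrable \<mu> \<phi>"
  by (rule continuous_bounded_measurable[OF assms(1)]) (rule borel_probs_integrable[OF assms(2)])

text \<open>The constant sequence \<open>\<mu>\<close> converges to \<open>\<mu>\<close> and to \<open>\<nu>\<close>, and limits in a metric space are unique.\<close>

lemma borel_probs_eqI:
  assumes "\<mu> \<in> borel_probs" "\<nu> \<in> borel_probs"
    and "\<And>\<phi> :: 'a \<Rightarrow> complex. continuous_on UNIV \<phi> \<Longrightarrow> (\<integral>x. \<phi> x \<partial>\<mu>) = (\<integral>x. \<phi> x \<partial>\<nu>)"
  shows "\<mu> = \<nu>"
proof (rule limitin_metric_unique)
  show "limitin mtopology (\<lambda>_::nat. \<mu>) \<mu> sequentially" "limitin mtopology (\<lambda>_::nat. \<mu>) \<nu> sequentially"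
    using assms by (auto simp: mtopology_weak_star limitin_weak_star topspace_weak_star)
qed simp

lemma limitin_weak_star_dist_null:
  "limitin weak_star \<nu> \<mu> F \<longleftrightarrow>
     \<mu> \<in> borel_probs \<and> (\<forall>\<^sub>F i in F. \<nu> i \<in> borel_probs) \<and> ((\<lambda>i. d (\<nu> i) \<mu>) \<longlongrightarrow> 0) F"
  using limitin_metric_dist_null[of \<nu> \<mu> F] by (simp add: mtopology_weak_star)

end

locale random_perturbation = metrized_weak_star d
  for d :: "'a::metric_space measure \<Rightarrow> 'a measure \<Rightarrow> real" +
  fixes m :: "'a measure" and f :: "'a \<Rightarrow> 'a"
  assumes sets_m: "sets m = sets borel"
    and finite_m: "finite_measure m"
    and open_pos: "open V \<Longrightarrow> V \<noteq> {} \<Longrightarrow> 0 < emeasure m V"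
    and cont_f: "continuous_on UNIV f"
begin

lemma noise_kernel_borel_probs:
  assumes "0 < \<epsilon>"
  shows "noise_kernel m f \<epsilon> x \<in> borel_probs"
proof -
  have "emeasure m (ball (f x) \<epsilon>) \<noteq> 0" using open_pos[of "ball (f x) \<epsilon>"] assms by auto
  moreover have "emeasure m (ball (f x) \<epsilon>) \<noteq> \<infinity>"
    using finite_measure.emeasure_finite[OF finite_m] by simp
  ultimately show ?thesis
    by (simp add: noise_kernel_def borel_probs_def sets_m prob_space_uniform_measure)
qed

text \<open>The function is lower semicontinuous: slightly smaller balls around \<open>f x\<close> already have almost the same
  measure, and they are contained in the balls of radius \<open>\<epsilon>\<close> around nearby points.\<close>

lemma emeasure_ball_measurable:
  assumes B: "B \<in> sets borel"
  shows "(\<lambda>x. emeasure m (ball (f x) \<epsilon> \<inter> B)) \<in> borel_measurable borel"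
proof (rule borel_measurableI_greater)
  fix a :: ennreal
  have "open {x. a < emeasure m (ball (f x) \<epsilon> \<inter> B)}"
    unfolding open_dist
  proof
    fix x assume "x \<in> {x. a < emeasure m (ball (f x) \<epsilon> \<inter> B)}"
    then have a: "a < emeasure m (ball (f x) \<epsilon> \<inter> B)" by simp
    define S where "S k = ball (f x) (\<epsilon> - 1 / Suc k) \<inter> B" for k
    have "incseq S"
    proof (intro incseq_SucI)
      fix k
      have "1 / real (Suc (Suc k)) \<le> 1 / real (Suc k)" by (simp add: frac_le)
      then show "S k \<le> S (Suc k)" unfolding S_def by (intro Int_mono subset_ball order_refl) linarith
    qed
    moreover have "range S \<subseteq> sets m" using B by (auto simp: S_def sets_m)
    moreover have "(\<Union>k. S k) = ball (f x) \<epsilon> \<inter> B"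
    proof safe
      fix y assume y: "y \<in> ball (f x) \<epsilon>" "y \<in> B"
      then obtain k where "1 / Suc k < \<epsilon> - dist (f x) y"
        using nat_approx_posE[of "\<epsilon> - dist (f x) y"] by auto
      then show "y \<in> (\<Union>k. S k)" using y by (auto simp: S_def intro!: exI[of _ k])
    next
      fix y k assume "y \<in> S k"
      moreover have "0 < 1 / real (Suc k)" by simp
      ultimately show "y \<in> ball (f x) \<epsilon>"
        unfolding S_def Int_iff mem_ball by linarith
    qed (auto simp: S_def)
    ultimately have "(SUP k. emeasure m (S k)) = emeasure m (ball (f x) \<epsilon> \<inter> B)"
      using SUP_emeasure_incseq[of S m] by simp
    with a obtain k where k: "a < emeasure m (S k)" by (metis less_SUP_iff)
    obtain r where r: "r > 0" "\<And>y. dist y x < r \<Longrightarrow> dist (f y) (f x) < 1 / Suc k"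
      using cont_f unfolding continuous_on_iff by (metis UNIV_I zero_less_divide_1_iff of_nat_0_less_iff zero_less_Suc)
    have "a < emeasure m (ball (f y) \<epsilon> \<inter> B)" if "dist y x < r" for y
    proof -
      have "S k \<subseteq> ball (f y) \<epsilon> \<inter> B"
      proof
        fix z assume "z \<in> S k"
        with r(2)[OF that] dist_triangle[of "f y" z "f x"] show "z \<in> ball (f y) \<epsilon> \<inter> B"
          by (auto simp: S_def)
      qed
      then have "emeasure m (S k) \<le> emeasure m (ball (f y) \<epsilon> \<inter> B)"
        by (rule emeasure_mono) (use B in \<open>auto simp: sets_m\<close>)
      with k show ?thesis by simp
    qed
    then show "\<exists>e>0. \<forall>y. dist y x < e \<longrightarrow> y \<in> {x. a < emeasure m (ball (f x) \<epsilon> \<inter> B)}"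
      using r(1) by blast
  qed
  then have "{x. a < emeasure m (ball (f x) \<epsilon> \<inter> B)} \<in> sets borel" by (rule borel_open)
  then show "{x \<in> space (borel :: 'a measure). a < emeasure m (ball (f x) \<epsilon> \<inter> B)} \<in> sets borel"
    by simp
qed

lemma noise_kernel_measurable:
  assumes "0 < \<epsilon>"
  shows "noise_kernel m f \<epsilon> \<in> measurable borel (subprob_algebra borel)"
proof (rule measurable_subprob_algebra)
  fix B :: "'a set" assume B: "B \<in> sets borel"
  note [measurable] = emeasure_ball_measurable[OF B] emeasure_ball_measurable[of UNIV, simplified]
  show "(\<lambda>x. emeasure (noise_kernel m f \<epsilon> x) B) \<in> borel_measurable borel"
    unfolding noise_kernel_def using B by (subst emeasure_uniform_measure) (auto simp: sets_m)
qed (use noise_kernel_borel_probs[OF assms] in \<open>auto simp: borel_probs_def prob_space_imp_subprob_space\<close>)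

lemma noise_kernel_measurable':
  assumes "0 < \<epsilon>" "\<mu> \<in> borel_probs"
  shows "noise_kernel m f \<epsilon> \<in> measurable \<mu> (subprob_algebra borel)"
  using noise_kernel_measurable[OF assms(1)] assms(2)
  by (simp add: borel_probs_def cong: measurable_cong_sets)

text \<open>The measure \<open>\<mu> \<bind> noise_kernel m f \<epsilon>\<close> has the integrals that define the dual operator, and
  \<open>borel_probs_eqI\<close> shows that no other measure has.\<close>

lemma
  assumes \<epsilon>: "0 < \<epsilon>" and \<mu>: "\<mu> \<in> borel_probs"
  shows dual_transfer_op_borel_probs: "dual_transfer_op m f \<epsilon> \<mu> \<in> borel_probs"
    and integral_dual_transfer_op: "continuous_on UNIV \<phi> \<Longrightarrow>
      (\<integral>x. \<phi> x \<partial>dual_transfer_op m f \<epsilon> \<mu>) = (\<integral>x. transfer_op m f \<epsilon> \<phi> x \<partial>\<mu>)"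
proof -
  let ?P = "\<lambda>\<nu>. \<nu> \<in> borel_probs \<and> (\<forall>\<phi> :: 'a \<Rightarrow> complex. continuous_on UNIV \<phi> \<longrightarrow>
        (\<integral>x. \<phi> x \<partial>\<nu>) = (\<integral>x. transfer_op m f \<epsilon> \<phi> x \<partial>\<mu>))"
  have p: "prob_space \<mu>" using \<mu> by (simp add: borel_probs_def)
  note K = noise_kernel_measurable'[OF \<epsilon> \<mu>] p noise_kernel_borel_probs[OF \<epsilon>]
  have P: "?P (\<mu> \<bind> noise_kernel m f \<epsilon>)"
    using bind_borel_probs[OF K] continuous_bounded_measurable integral_bind_complex[OF _ _ K]
    unfolding transfer_op_def by metis
  have "?P (dual_transfer_op m f \<epsilon> \<mu>)"
    unfolding dual_transfer_op_def
    by (rule theI[of ?P, OF P]) (use P in \<open>auto intro: borel_probs_eqI\<close>)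
  then show "dual_transfer_op m f \<epsilon> \<mu> \<in> borel_probs"
    "continuous_on UNIV \<phi> \<Longrightarrow>
      (\<integral>x. \<phi> x \<partial>dual_transfer_op m f \<epsilon> \<mu>) = (\<integral>x. transfer_op m f \<epsilon> \<phi> x \<partial>\<mu>)"
    by auto
qed

lemma return_borel_probs: "return borel x \<in> borel_probs"
  by (simp add: borel_probs_def prob_space_return)

lemma iterated_dual_borel_probs:
  assumes "0 < \<epsilon>"
  shows "(dual_transfer_op m f \<epsilon> ^^ j) (return borel x) \<in> borel_probs"
  by (induction j) (auto simp: return_borel_probs dual_transfer_op_borel_probs[OF assms])

text \<open>The value \<open>transfer_op m f \<epsilon> \<phi> x\<close> is a mean of \<open>\<phi>\<close> over the ball of radius \<open>\<epsilon>\<close> around \<open>f x\<close>, and \<open>\<phi>\<close>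
  is uniformly continuous.\<close>

lemma transfer_op_close:
  fixes \<phi> :: "'a \<Rightarrow> complex"
  assumes \<phi>: "continuous_on UNIV \<phi>" and e: "0 < e"
  shows "\<exists>\<epsilon>0>0. \<forall>\<epsilon> x. 0 < \<epsilon> \<and> \<epsilon> \<le> \<epsilon>0 \<longrightarrow> norm (transfer_op m f \<epsilon> \<phi> x - \<phi> (f x)) \<le> e"
proof -
  obtain \<epsilon>0 where \<epsilon>0: "\<epsilon>0 > 0" "\<And>x y. dist y x < \<epsilon>0 \<Longrightarrow> dist (\<phi> y) (\<phi> x) < e"
    using compact_uniformly_continuous[OF \<phi> compact_UNIV] e
    unfolding uniformly_continuous_on_def by (metis UNIV_I)
  have "norm (transfer_op m f \<epsilon> \<phi> x - \<phi> (f x)) \<le> e" if \<epsilon>: "0 < \<epsilon>" "\<epsilon> \<le> \<epsilon>0" for \<epsilon> x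
  proof -
    let ?K = "noise_kernel m f \<epsilon> x"
    interpret K: prob_space ?K using noise_kernel_borel_probs[OF \<epsilon>(1)] by (simp add: borel_probs_def)
    have int: "integrable ?K \<phi>" by (rule continuous_integrable[OF \<phi> noise_kernel_borel_probs[OF \<epsilon>(1)]])
    have "AE y in ?K. norm (\<phi> y - \<phi> (f x)) \<le> e"
      unfolding noise_kernel_def using \<epsilon> \<epsilon>0(2)
      by (intro AE_uniform_measureI AE_I2) (auto simp: sets_m dist_norm dist_commute intro: less_imp_le)
    then have "(\<integral>y. norm (\<phi> y - \<phi> (f x)) \<partial>?K) \<le> e"
      using int by (intro K.integral_le_const) auto
    then have "norm (\<integral>y. \<phi> y - \<phi> (f x) \<partial>?K) \<le> e"
      by (rule order_trans[OF integral_norm_bound])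
    then show ?thesis using int by (simp add: transfer_op_def K.prob_space)
  qed
  then show ?thesis using \<epsilon>0(1) by blast
qed

text \<open>One step of the dual operator turns the test function \<open>\<phi>\<close> into \<open>transfer_op m f \<epsilon> \<phi>\<close>, which is uniformly close
  to \<open>\<phi> \<circ> f\<close>; the induction hypothesis is then applied to the continuous function \<open>\<phi> \<circ> f\<close>, hence the
  generalization over \<open>\<phi>\<close>.\<close>

lemma iterated_dual_close:
  fixes \<phi> :: "'a \<Rightarrow> complex"
  assumes \<phi>: "continuous_on UNIV \<phi>" and e: "0 < e"
  shows "\<exists>\<epsilon>0>0. \<forall>\<epsilon> x. 0 < \<epsilon> \<and> \<epsilon> \<le> \<epsilon>0 \<longrightarrow>
    norm ((\<integral>y. \<phi> y \<partial>(dual_transfer_op m f \<epsilon> ^^ j) (return borel x)) - \<phi> ((f ^^ j) x)) \<le> e"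
  using \<phi> e
proof (induction j arbitrary: \<phi> e)
  case 0
  then show ?case
    by (auto simp: integral_return borel_measurable_continuous_onI intro!: exI[of _ 1])
next
  case (Suc j)
  have \<phi>f: "continuous_on UNIV (\<lambda>x. \<phi> (f x))"
    using continuous_on_compose2[OF Suc.prems(1) cont_f] by simp
  obtain \<epsilon>1 where \<epsilon>1: "\<epsilon>1 > 0" "\<And>\<epsilon> x. 0 < \<epsilon> \<Longrightarrow> \<epsilon> \<le> \<epsilon>1 \<Longrightarrow>
      norm ((\<integral>y. \<phi> (f y) \<partial>(dual_transfer_op m f \<epsilon> ^^ j) (return borel x)) - \<phi> (f ((f ^^ j) x))) \<le> e / 2"
    using Suc.IH[OF \<phi>f, of "e / 2"] Suc.prems(2) by auto
  obtain \<epsilon>2 where \<epsilon>2: "\<epsilon>2 > 0" "\<And>\<epsilon> x. 0 < \<epsilon> \<Longrightarrow> \<epsilon> \<le> \<epsilon>2 \<Longrightarrow>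
      norm (transfer_op m f \<epsilon> \<phi> x - \<phi> (f x)) \<le> e / 2"
    using transfer_op_close[OF Suc.prems(1), of "e / 2"] Suc.prems(2) by auto
  have "norm ((\<integral>y. \<phi> y \<partial>(dual_transfer_op m f \<epsilon> ^^ Suc j) (return borel x)) - \<phi> ((f ^^ Suc j) x)) \<le> e"
    if \<epsilon>: "0 < \<epsilon>" "\<epsilon> \<le> min \<epsilon>1 \<epsilon>2" for \<epsilon> x
  proof -
    define \<nu> where "\<nu> = (dual_transfer_op m f \<epsilon> ^^ j) (return borel x)"
    have \<nu>: "\<nu> \<in> borel_probs" unfolding \<nu>_def by (rule iterated_dual_borel_probs[OF \<epsilon>(1)])
    obtain C where C: "\<phi> \<in> borel_measurable borel" "\<And>x. norm (\<phi> x) \<le> C"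
      using continuous_bounded_measurable[OF Suc.prems(1)] by blast
    have int: "integrable \<nu> (transfer_op m f \<epsilon> \<phi>)"
      unfolding transfer_op_def
      by (rule borel_probs_integrable[OF \<nu>]) (use \<epsilon>(1) C in \<open>auto intro!: integral_kernel_measurable
          norm_integral_le_borel_probs noise_kernel_borel_probs noise_kernel_measurable\<close>)
    have "(\<integral>y. \<phi> y \<partial>(dual_transfer_op m f \<epsilon> ^^ Suc j) (return borel x)) = (\<integral>y. transfer_op m f \<epsilon> \<phi> y \<partial>\<nu>)"
      using integral_dual_transfer_op[OF \<epsilon>(1) \<nu> Suc.prems(1)] by (simp add: \<nu>_def)
    also have "\<dots> = (\<integral>y. transfer_op m f \<epsilon> \<phi> y - \<phi> (f y) \<partial>\<nu>) + (\<integral>y. \<phi> (f y) \<partial>\<nu>)"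
      using int continuous_integrable[OF \<phi>f \<nu>] by simp
    finally have "norm ((\<integral>y. \<phi> y \<partial>(dual_transfer_op m f \<epsilon> ^^ Suc j) (return borel x)) - \<phi> ((f ^^ Suc j) x))
        \<le> norm (\<integral>y. transfer_op m f \<epsilon> \<phi> y - \<phi> (f y) \<partial>\<nu>) + norm ((\<integral>y. \<phi> (f y) \<partial>\<nu>) - \<phi> (f ((f ^^ j) x)))"
      by (simp add: norm_triangle_ineq add_diff_eq[symmetric])
    also have "\<dots> \<le> e / 2 + e / 2"
      using \<epsilon> \<epsilon>1(2) \<epsilon>2(2) unfolding \<nu>_def[symmetric]
      by (intro add_mono norm_integral_le_borel_probs[OF \<nu>]) (auto simp: \<nu>_def)
    finally show ?thesis by simp
  qed
  then show ?case using \<epsilon>1(1) \<epsilon>2(1) by (intro exI[of _ "min \<epsilon>1 \<epsilon>2"]) auto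
qed

lemma
  assumes "n \<ge> 1"
  shows empiric_borel_probs: "empiric f n x \<in> borel_probs"
    and empiric_stochastic_borel_probs: "0 < \<epsilon> \<Longrightarrow> empiric_stochastic m f \<epsilon> n x \<in> borel_probs"
  using assms unfolding empiric_def empiric_stochastic_def
  by (auto intro!: average_measure_borel_probs return_borel_probs iterated_dual_borel_probs)

lemma continuous_iterate: "continuous_on UNIV (f ^^ j)"
proof (induction j)
  case (Suc j)
  then show ?case using continuous_on_compose[OF Suc, of f] cont_f continuous_on_subset by auto
qed (simp add: continuous_on_id id_def)

lemma integral_empiric:
  fixes \<phi> :: "'a \<Rightarrow> complex"
  assumes "continuous_on UNIV \<phi>" "n \<ge> 1"
  shows "(\<integral>y. \<phi> y \<partial>empiric f n x) = (\<Sum>j = 1..n. \<phi> ((f ^^ j) x)) / of_nat n"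
proof -
  obtain C where C: "\<phi> \<in> borel_measurable borel" "\<And>x. norm (\<phi> x) \<le> C"
    using continuous_bounded_measurable[OF assms(1)] by blast
  show ?thesis
    unfolding empiric_def using C(1)
    by (simp add: integral_average_measure[OF assms(2) return_borel_probs C] integral_return)
qed

lemma empiric_continuous:
  assumes "X \<longlonglongrightarrow> x" "n \<ge> 1"
  shows "limitin weak_star (\<lambda>i. empiric f n (X i)) (empiric f n x) sequentially"
  unfolding limitin_weak_star
proof (intro conjI allI impI)
  fix \<phi> :: "'a \<Rightarrow> complex" assume \<phi>: "continuous_on UNIV \<phi>"
  have "(\<lambda>i. \<phi> ((f ^^ j) (X i))) \<longlonglongrightarrow> \<phi> ((f ^^ j) x)" for j
    by (intro continuous_on_tendsto_compose[OF \<phi>] continuous_on_tendsto_compose[OF continuous_iterate] assms)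
      auto
  then show "(\<lambda>i. \<integral>y. \<phi> y \<partial>empiric f n (X i)) \<longlonglongrightarrow> (\<integral>y. \<phi> y \<partial>empiric f n x)"
    unfolding integral_empiric[OF \<phi> assms(2)] using assms(2) by (auto intro!: tendsto_intros)
qed (use assms empiric_borel_probs in auto)

text \<open>The starting point may vary with the noise level; this is what makes the compactness argument
  for uniformity in \<open>x\<close> possible.\<close>

lemma empiric_stochastic_zero_noise_limit:
  assumes X: "X \<longlonglongrightarrow> x" and n: "n \<ge> 1" and \<epsilon>: "\<epsilon> \<longlonglongrightarrow> 0" "\<And>i. 0 < \<epsilon> i"
  shows "limitin weak_star (\<lambda>i. empiric_stochastic m f (\<epsilon> i) n (X i)) (empiric f n x) sequentially"
  unfolding limitin_weak_star
proof (intro conjI allI impI)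
  fix \<phi> :: "'a \<Rightarrow> complex" assume \<phi>: "continuous_on UNIV \<phi>"
  obtain C where C: "\<phi> \<in> borel_measurable borel" "\<And>x. norm (\<phi> x) \<le> C"
    using continuous_bounded_measurable[OF \<phi>] by blast
  define I where "I j i = (\<integral>y. \<phi> y \<partial>(dual_transfer_op m f (\<epsilon> i) ^^ j) (return borel (X i)))" for j i
  have "(\<lambda>i. I j i - \<phi> ((f ^^ j) (X i))) \<longlonglongrightarrow> 0" for j
  proof (rule LIMSEQ_I)
    fix r :: real assume "0 < r"
    then obtain \<epsilon>0 where \<epsilon>0: "\<epsilon>0 > 0" "\<And>\<epsilon> x. 0 < \<epsilon> \<Longrightarrow> \<epsilon> \<le> \<epsilon>0 \<Longrightarrow>
      norm ((\<integral>y. \<phi> y \<partial>(dual_transfer_op m f \<epsilon> ^^ j) (return borel x)) - \<phi> ((f ^^ j) x)) \<le> r / 2"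
      using iterated_dual_close[OF \<phi>, of "r / 2" j] by auto
    have "\<forall>\<^sub>F i in sequentially. \<epsilon> i < \<epsilon>0" by (rule order_tendstoD(2)[OF \<epsilon>(1) \<epsilon>0(1)])
    then have "\<forall>\<^sub>F i in sequentially. norm (I j i - \<phi> ((f ^^ j) (X i)) - 0) < r"
    proof eventually_elim
      case (elim i)
      then show ?case using \<epsilon>0(2)[OF \<epsilon>(2), of i "X i"] \<open>0 < r\<close> by (simp add: I_def)
    qed
    then show "\<exists>no. \<forall>i\<ge>no. norm (I j i - \<phi> ((f ^^ j) (X i)) - 0) < r"
      by (simp add: eventually_sequentially)
  qed
  moreover have "(\<lambda>i. \<phi> ((f ^^ j) (X i))) \<longlonglongrightarrow> \<phi> ((f ^^ j) x)" for j
    by (intro continuous_on_tendsto_compose[OF \<phi>] continuous_on_tendsto_compose[OF continuous_iterate] X)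
      auto
  ultimately have "(\<lambda>i. (I j i - \<phi> ((f ^^ j) (X i))) + \<phi> ((f ^^ j) (X i))) \<longlonglongrightarrow> 0 + \<phi> ((f ^^ j) x)" for j
    by (intro tendsto_add)
  then have "(\<lambda>i. (\<Sum>j = 1..n. I j i) / of_nat n) \<longlonglongrightarrow> (\<integral>y. \<phi> y \<partial>empiric f n x)"
    unfolding integral_empiric[OF \<phi> n] using n by (auto intro!: tendsto_intros)
  moreover have "(\<integral>y. \<phi> y \<partial>empiric_stochastic m f (\<epsilon> i) n (X i)) = (\<Sum>j = 1..n. I j i) / of_nat n" for i
    unfolding empiric_stochastic_def I_def
    by (rule integral_average_measure[OF n iterated_dual_borel_probs[OF \<epsilon>(2)] C])
  ultimately show "(\<lambda>i. \<integral>y. \<phi> y \<partial>empiric_stochastic m f (\<epsilon> i) n (X i)) \<longlonglongrightarrow> (\<integral>y. \<phi> y \<partial>empiric f n x)"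
    by simp
qed (use n \<epsilon> empiric_borel_probs empiric_stochastic_borel_probs in auto)

text \<open>Closeness of integrals is uniform in \<open>x\<close> only for each test function separately, so the passage to the metric
  \<open>d\<close> goes by contradiction: along bad points \<open>X i\<close> with noise tending to 0, a subsequence of \<open>X\<close>
  converges to some \<open>x\<close>, and both the noisy and the noiseless averages then converge to \<open>empiric f n x\<close>.\<close>

lemma empiric_stochastic_uniformly_close:
  assumes n: "n \<ge> 1" and \<rho>: "0 < \<rho>"
  obtains \<epsilon>0 where "\<epsilon>0 > 0"
    "\<And>\<epsilon> x. 0 < \<epsilon> \<Longrightarrow> \<epsilon> \<le> \<epsilon>0 \<Longrightarrow> d (empiric_stochastic m f \<epsilon> n x) (empiric f n x) < \<rho>"
proof (rule ccontr)
  assume "\<not> thesis"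
  with that have "\<exists>\<epsilon> x. 0 < \<epsilon> \<and> \<epsilon> \<le> 1 / real (Suc i) \<and>
      \<rho> \<le> d (empiric_stochastic m f \<epsilon> n x) (empiric f n x)" for i
    by (metis not_le zero_less_divide_1_iff of_nat_0_less_iff zero_less_Suc)
  then obtain \<epsilon> X where X: "\<And>i. 0 < \<epsilon> i" "\<And>i. \<epsilon> i \<le> 1 / real (Suc i)"
    "\<And>i. \<rho> \<le> d (empiric_stochastic m f (\<epsilon> i) n (X i)) (empiric f n (X i))" by metis
  have \<epsilon>: "\<epsilon> \<longlonglongrightarrow> 0"
    by (rule tendsto_sandwich[OF _ _ tendsto_const LIMSEQ_inverse_real_of_nat])
      (use X in \<open>auto simp: inverse_eq_divide less_imp_le\<close>)
  obtain x r where r: "strict_mono r" "(X \<circ> r) \<longlonglongrightarrow> x"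
    using compact_UNIV by (metis UNIV_I compact_def)
  let ?s = "\<lambda>i. empiric_stochastic m f (\<epsilon> (r i)) n (X (r i))" and ?e = "\<lambda>i. empiric f n (X (r i))"
  have "(\<lambda>i. d (?s i) (empiric f n x)) \<longlonglongrightarrow> 0"
    using empiric_stochastic_zero_noise_limit[OF r(2) n LIMSEQ_subseq_LIMSEQ[OF \<epsilon> r(1)]] X(1)
    by (simp add: limitin_weak_star_dist_null o_def)
  moreover have "(\<lambda>i. d (?e i) (empiric f n x)) \<longlonglongrightarrow> 0"
    using empiric_continuous[OF r(2) n] by (simp add: limitin_weak_star_dist_null o_def)
  ultimately have "(\<lambda>i. d (?s i) (empiric f n x) + d (?e i) (empiric f n x)) \<longlonglongrightarrow> 0 + 0"
    by (rule tendsto_add)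
  then have "\<forall>\<^sub>F i in sequentially. d (?s i) (empiric f n x) + d (?e i) (empiric f n x) < \<rho>"
    using \<rho> by (intro order_tendstoD(2)) auto
  then obtain i where "d (?s i) (empiric f n x) + d (?e i) (empiric f n x) < \<rho>"
    by (auto simp: eventually_sequentially)
  moreover have "d (?s i) (?e i) \<le> d (?s i) (empiric f n x) + d (?e i) (empiric f n x)"
    using triangle[of "?s i" "empiric f n x" "?e i"] commute[of "empiric f n x" "?e i"] X(1) n
    by (simp add: empiric_borel_probs empiric_stochastic_borel_probs)
  ultimately show False using X(3)[of "r i"] by simp
qed

section \<open>Basins, physical measures and stable measures\<close>

text \<open>If the averages did not converge to \<open>\<mu>\<close>, some subsequence would stay away from \<open>\<mu>\<close>, and by sequential
  compactness it would have a limit point in \<open>p_omega f x\<close> different from \<open>\<mu>\<close>.\<close>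

lemma strong_basin_iff:
  assumes \<mu>: "\<mu> \<in> borel_probs"
  shows "x \<in> strong_basin f \<mu> \<longleftrightarrow> (\<lambda>n. d (empiric f n x) \<mu>) \<longlonglongrightarrow> 0"
proof
  assume lim: "(\<lambda>n. d (empiric f n x) \<mu>) \<longlonglongrightarrow> 0"
  have "\<forall>\<^sub>F n in sequentially. empiric f n x \<in> borel_probs"
    using empiric_borel_probs unfolding eventually_sequentially by blast
  then have lim': "limitin weak_star (\<lambda>n. empiric f n x) \<mu> sequentially"
    using lim \<mu> by (simp add: limitin_weak_star_dist_null)
  have "\<mu> \<in> p_omega f x"
    unfolding p_omega_def using lim' by (auto intro!: exI[of _ "\<lambda>i. i"] simp: strict_mono_def)
  moreover have "\<nu> = \<mu>" if \<nu>: "\<nu> \<in> p_omega f x" for \<nu>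
  proof -
    obtain r where r: "strict_mono r" "limitin weak_star (\<lambda>i. empiric f (r i) x) \<nu> sequentially"
      using \<nu> unfolding p_omega_def by blast
    have "limitin weak_star (\<lambda>i. empiric f (r i) x) \<mu> sequentially"
      using limitin_subsequence[OF r(1) lim'] by (simp add: o_def)
    then show ?thesis
      using limitin_metric_unique[of "\<lambda>i. empiric f (r i) x" \<nu> sequentially \<mu>] r(2)
      by (simp add: mtopology_weak_star)
  qed
  ultimately show "x \<in> strong_basin f \<mu>" unfolding strong_basin_def by blast
next
  assume x: "x \<in> strong_basin f \<mu>"
  show "(\<lambda>n. d (empiric f n x) \<mu>) \<longlonglongrightarrow> 0"
  proof (rule ccontr)
    assume "\<not> ?thesis"
    then obtain \<rho> where \<rho>: "0 < \<rho>" "\<not> (\<forall>\<^sub>F n in sequentially. d (empiric f n x) \<mu> < \<rho>)"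
      unfolding tendsto_iff by (auto simp: dist_real_def)
    \<comment> \<open>Index 0 is excluded because \<open>empiric f 0 x\<close> is not a probability.\<close>
    define F where "F = {n. 1 \<le> n \<and> \<rho> \<le> d (empiric f n x) \<mu>}"
    have "infinite F"
      unfolding infinite_nat_iff_unbounded_le
    proof
      fix k
      obtain n where "max k 1 \<le> n" "\<not> d (empiric f n x) \<mu> < \<rho>"
        using \<rho>(2) unfolding eventually_sequentially by blast
      then show "\<exists>n\<ge>k. n \<in> F" unfolding F_def by (intro exI[of _ n]) simp
    qed
    define s where "s = enumerate F"
    have s: "strict_mono s" "\<And>i. s i \<in> F"
      unfolding s_def using \<open>infinite F\<close> by (auto intro: strict_mono_enumerate enumerate_in_set)
    have "empiric f (s i) x \<in> borel_probs" for i
      using s(2)[of i] by (intro empiric_borel_probs) (simp add: F_def)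
    then obtain r \<nu> where r: "strict_mono r" and \<nu>: "limitin weak_star (\<lambda>i. empiric f (s (r i)) x) \<nu> sequentially"
      using borel_probs_sequentially_compact[OF compact_UNIV, of "\<lambda>i. empiric f (s i) x"] by blast
    have "strict_mono (\<lambda>i. s (r i))" using strict_mono_o[OF s(1) r] by (simp add: o_def)
    then have "\<nu> \<in> p_omega f x" using \<nu> unfolding p_omega_def by blast
    then have "\<nu> = \<mu>" using x unfolding strong_basin_def by blast
    then have "(\<lambda>i. d (empiric f (s (r i)) x) \<mu>) \<longlonglongrightarrow> 0" using \<nu> by (simp add: limitin_weak_star_dist_null)
    then have "\<forall>\<^sub>F i in sequentially. d (empiric f (s (r i)) x) \<mu> < \<rho>" using \<rho>(1) by (rule order_tendstoD)
    then obtain i where "d (empiric f (s (r i)) x) \<mu> < \<rho>" unfolding eventually_sequentially by blast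
    then show False using s(2)[of "r i"] by (simp add: F_def)
  qed
qed

lemma zero_noise_triangle:
  assumes "\<mu> \<in> borel_probs" "n \<ge> 1" "0 < \<epsilon>"
    and "d (empiric_stochastic m f \<epsilon> n x) (empiric f n x) < \<rho> / 2"
  shows "d (empiric f n x) \<mu> < \<rho> / 2 \<Longrightarrow> d (empiric_stochastic m f \<epsilon> n x) \<mu> < \<rho>"
    and "d (empiric_stochastic m f \<epsilon> n x) \<mu> < \<rho> / 2 \<Longrightarrow> d (empiric f n x) \<mu> < \<rho>"
  using assms triangle[of "empiric_stochastic m f \<epsilon> n x" "empiric f n x" \<mu>]
    triangle[of "empiric f n x" "empiric_stochastic m f \<epsilon> n x" \<mu>]
    commute[of "empiric f n x" "empiric_stochastic m f \<epsilon> n x"]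
    empiric_borel_probs[OF assms(2), of x] empiric_stochastic_borel_probs[OF assms(2,3), of x]
  by simp_all

lemma stochastic_basin_iff:
  assumes \<mu>: "\<mu> \<in> borel_probs"
  shows "x \<in> stochastic_basin m f d \<mu> \<longleftrightarrow> (\<lambda>n. d (empiric f n x) \<mu>) \<longlonglongrightarrow> 0"
proof
  assume x: "x \<in> stochastic_basin m f d \<mu>"
  show "(\<lambda>n. d (empiric f n x) \<mu>) \<longlonglongrightarrow> 0"
    unfolding tendsto_iff
  proof (intro allI impI)
    fix \<rho> :: real assume \<rho>: "0 < \<rho>"
    have "\<exists>N\<ge>1. \<forall>n\<ge>N. \<exists>\<epsilon>0>0. \<forall>\<epsilon>. 0 < \<epsilon> \<and> \<epsilon> \<le> \<epsilon>0 \<longrightarrow>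
        d (empiric_stochastic m f \<epsilon> n x) \<mu> < \<rho> / 2"
      using x half_gt_zero[OF \<rho>] unfolding stochastic_basin_def by blast
    then obtain N where N: "N \<ge> 1" "\<And>n. n \<ge> N \<Longrightarrow> \<exists>\<epsilon>0>0. \<forall>\<epsilon>. 0 < \<epsilon> \<and> \<epsilon> \<le> \<epsilon>0 \<longrightarrow>
        d (empiric_stochastic m f \<epsilon> n x) \<mu> < \<rho> / 2"
      by blast
    have "d (empiric f n x) \<mu> < \<rho>" if nN: "n \<ge> N" for n
    proof -
      have n: "n \<ge> 1" using N(1) nN by simp
      obtain \<epsilon>0 where \<epsilon>0: "\<epsilon>0 > 0" "\<And>\<epsilon>. 0 < \<epsilon> \<Longrightarrow> \<epsilon> \<le> \<epsilon>0 \<Longrightarrow> d (empiric_stochastic m f \<epsilon> n x) \<mu> < \<rho> / 2"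
        using N(2)[OF nN] by blast
      obtain \<epsilon>1 where \<epsilon>1: "\<epsilon>1 > 0"
        "\<And>\<epsilon> x. 0 < \<epsilon> \<Longrightarrow> \<epsilon> \<le> \<epsilon>1 \<Longrightarrow> d (empiric_stochastic m f \<epsilon> n x) (empiric f n x) < \<rho> / 2"
        using empiric_stochastic_uniformly_close[OF n, of "\<rho> / 2"] \<rho> by auto
      show ?thesis
        by (rule zero_noise_triangle(2)[OF \<mu> n, of "min \<epsilon>0 \<epsilon>1"]) (use \<epsilon>0 \<epsilon>1 in auto)
    qed
    then show "\<forall>\<^sub>F n in sequentially. dist (d (empiric f n x) \<mu>) 0 < \<rho>"
      unfolding eventually_sequentially by (auto simp: dist_real_def)
  qed
next
  assume lim: "(\<lambda>n. d (empiric f n x) \<mu>) \<longlonglongrightarrow> 0"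
  show "x \<in> stochastic_basin m f d \<mu>"
    unfolding stochastic_basin_def
  proof (intro CollectI allI impI)
    fix \<rho> :: real assume \<rho>: "0 < \<rho>"
    have "\<forall>\<^sub>F n in sequentially. d (empiric f n x) \<mu> < \<rho> / 2"
      using lim \<rho> by (intro order_tendstoD(2)) auto
    then obtain N where N: "\<And>n. n \<ge> N \<Longrightarrow> d (empiric f n x) \<mu> < \<rho> / 2"
      unfolding eventually_sequentially by blast
    have "\<exists>\<epsilon>0>0. \<forall>\<epsilon>. 0 < \<epsilon> \<and> \<epsilon> \<le> \<epsilon>0 \<longrightarrow> d (empiric_stochastic m f \<epsilon> n x) \<mu> < \<rho>" if "n \<ge> max N 1" for n
    proof -
      have n: "n \<ge> 1" using that by simp
      obtain \<epsilon>1 where \<epsilon>1: "\<epsilon>1 > 0"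
        "\<And>\<epsilon> x. 0 < \<epsilon> \<Longrightarrow> \<epsilon> \<le> \<epsilon>1 \<Longrightarrow> d (empiric_stochastic m f \<epsilon> n x) (empiric f n x) < \<rho> / 2"
        using empiric_stochastic_uniformly_close[OF n, of "\<rho> / 2"] \<rho> by auto
      show ?thesis
        using zero_noise_triangle(1)[OF \<mu> n] \<epsilon>1 N[of n] that by (intro exI[of _ \<epsilon>1]) auto
    qed
    then show "\<exists>N\<ge>1. \<forall>n\<ge>N. \<exists>\<epsilon>0>0. \<forall>\<epsilon>. 0 < \<epsilon> \<and> \<epsilon> \<le> \<epsilon>0 \<longrightarrow>
        d (empiric_stochastic m f \<epsilon> n x) \<mu> < \<rho>"
      by (intro exI[of _ "max N 1"]) auto
  qed
qed

lemma stochastic_basin_eq_strong_basin: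
  "\<mu> \<in> borel_probs \<Longrightarrow> stochastic_basin m f d \<mu> = strong_basin f \<mu>"
  using strong_basin_iff stochastic_basin_iff by blast

text \<open>For fixed \<open>n\<close> this function is even continuous.\<close>

lemma empiric_dist_measurable:
  assumes \<mu>: "\<mu> \<in> borel_probs" and n: "n \<ge> 1"
  shows "(\<lambda>x. d (empiric f n x) \<mu>) \<in> borel_measurable m"
proof -
  have "continuous_on UNIV (\<lambda>x. d (empiric f n x) \<mu>)"
    unfolding continuous_on_sequentially
  proof (intro allI ballI impI)
    fix X :: "nat \<Rightarrow> 'a" and x assume "(\<forall>i. X i \<in> UNIV) \<and> X \<longlonglongrightarrow> x"
    then have lim: "(\<lambda>i. d (empiric f n (X i)) (empiric f n x)) \<longlonglongrightarrow> 0"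
      using empiric_continuous[of X x n] n by (simp add: limitin_weak_star_dist_null)
    have "norm (d (empiric f n (X i)) \<mu> - d (empiric f n x) \<mu>) \<le> d (empiric f n (X i)) (empiric f n x)" for i
      using triangle[of "empiric f n (X i)" "empiric f n x" \<mu>] triangle[of "empiric f n x" "empiric f n (X i)" \<mu>]
        commute[of "empiric f n x" "empiric f n (X i)"] empiric_borel_probs[OF n] \<mu> by simp
    then have "(\<lambda>i. d (empiric f n (X i)) \<mu> - d (empiric f n x) \<mu>) \<longlonglongrightarrow> 0"
      by (intro Lim_null_comparison[OF always_eventually lim] allI)
    then show "((\<lambda>x. d (empiric f n x) \<mu>) \<circ> X) \<longlonglongrightarrow> d (empiric f n x) \<mu>"
      by (simp add: LIM_zero_iff o_def)
  qed
  then show ?thesis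
    using borel_measurable_continuous_onI sets_m by (simp cong: measurable_cong_sets)
qed

text \<open>Convergence to 0 is a countable combination of conditions on the distances to \<open>\<mu>\<close>. The index is shifted
  because these distances are known to be measurable from length 1 on.\<close>

lemma strong_basin_sets:
  assumes \<mu>: "\<mu> \<in> borel_probs"
  shows "strong_basin f \<mu> \<in> sets m"
proof -
  note [measurable] = empiric_dist_measurable[OF \<mu>, of "Suc _"]
  have sp: "space m = UNIV" using sets_eq_imp_space_eq[OF sets_m] by simp
  have "x \<in> strong_basin f \<mu> \<longleftrightarrow> (\<forall>k. \<exists>N. \<forall>n. n \<ge> N \<longrightarrow> d (empiric f (Suc n) x) \<mu> < 1 / real (Suc k))" for x
  proof -
    have "x \<in> strong_basin f \<mu> \<longleftrightarrow> (\<lambda>n. d (empiric f (Suc n) x) \<mu>) \<longlonglongrightarrow> 0"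
      unfolding strong_basin_iff[OF \<mu>] by (rule filterlim_sequentially_Suc[symmetric])
    also have "\<dots> \<longleftrightarrow> (\<forall>k. \<exists>N. \<forall>n. n \<ge> N \<longrightarrow> d (empiric f (Suc n) x) \<mu> < 1 / real (Suc k))"
    proof safe
      fix k assume "(\<lambda>n. d (empiric f (Suc n) x) \<mu>) \<longlonglongrightarrow> 0"
      then have "\<forall>\<^sub>F n in sequentially. d (empiric f (Suc n) x) \<mu> < 1 / real (Suc k)"
        by (rule order_tendstoD) simp
      then show "\<exists>N. \<forall>n\<ge>N. d (empiric f (Suc n) x) \<mu> < 1 / real (Suc k)" by (simp add: eventually_sequentially)
    next
      assume *: "\<forall>k. \<exists>N. \<forall>n\<ge>N. d (empiric f (Suc n) x) \<mu> < 1 / real (Suc k)"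
      show "(\<lambda>n. d (empiric f (Suc n) x) \<mu>) \<longlonglongrightarrow> 0"
      proof (rule LIMSEQ_I)
        fix r :: real assume "0 < r"
        then obtain k where k: "1 / real (Suc k) < r" using nat_approx_posE by blast
        obtain N where "\<And>n. n \<ge> N \<Longrightarrow> d (empiric f (Suc n) x) \<mu> < 1 / real (Suc k)" using * by blast
        with k show "\<exists>no. \<forall>n\<ge>no. norm (d (empiric f (Suc n) x) \<mu> - 0) < r"
          by (intro exI[of _ N]) (auto intro: less_trans)
      qed
    qed
    finally show ?thesis .
  qed
  then have "strong_basin f \<mu> =
    {x \<in> space m. \<forall>k. \<exists>N. \<forall>n. n \<ge> N \<longrightarrow> d (empiric f (Suc n) x) \<mu> < 1 / real (Suc k)}"
    unfolding sp by blast
  also have "\<dots> \<in> sets m" by measurable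
  finally show ?thesis .
qed

text \<open>The set on which Egorov's theorem gives uniform convergence witnesses stability.\<close>

lemma physical_imp_stable:
  assumes "physical m f \<mu>"
  shows "empirically_stochastically_stable m f d \<mu>"
proof -
  have inv: "\<mu> \<in> invariant_probs f" and pos: "0 < emeasure m (strong_basin f \<mu>)"
    using assms by (auto simp: physical_def)
  then have \<mu>: "\<mu> \<in> borel_probs" by (simp add: invariant_probs_def)
  obtain T where T: "T \<in> sets m" "0 < emeasure m T"
    "\<And>\<rho>. 0 < \<rho> \<Longrightarrow> \<exists>N. \<forall>n\<ge>N. \<forall>x\<in>T. d (empiric f (Suc n) x) \<mu> < \<rho>"
  proof (rule egorov_positive_set[OF finite_m _ strong_basin_sets[OF \<mu>] pos])
    show "(\<lambda>x. d (empiric f (Suc n) x) \<mu>) \<in> borel_measurable m" for n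
      by (rule empiric_dist_measurable[OF \<mu>]) simp
    show "(\<lambda>n. d (empiric f (Suc n) x) \<mu>) \<longlonglongrightarrow> 0" if "x \<in> strong_basin f \<mu>" for x
      using that unfolding strong_basin_iff[OF \<mu>] by (rule LIMSEQ_Suc)
  qed blast
  have "\<exists>N\<ge>1. \<forall>n\<ge>N. \<exists>\<epsilon>0>0. \<forall>\<epsilon>. 0 < \<epsilon> \<and> \<epsilon> \<le> \<epsilon>0 \<longrightarrow>
      (AE x in m. x \<in> T \<longrightarrow> d (empiric_stochastic m f \<epsilon> n x) \<mu> < \<rho>)" if \<rho>: "0 < \<rho>" for \<rho>
  proof -
    obtain N where N: "\<And>n x. n \<ge> N \<Longrightarrow> x \<in> T \<Longrightarrow> d (empiric f (Suc n) x) \<mu> < \<rho> / 2"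
      using T(3)[of "\<rho> / 2"] \<rho> by auto
    have "\<exists>\<epsilon>0>0. \<forall>\<epsilon>. 0 < \<epsilon> \<and> \<epsilon> \<le> \<epsilon>0 \<longrightarrow>
      (AE x in m. x \<in> T \<longrightarrow> d (empiric_stochastic m f \<epsilon> n x) \<mu> < \<rho>)" if n: "n \<ge> Suc N" for n
    proof -
      have n1: "n \<ge> 1" using n by simp
      have close: "d (empiric f n x) \<mu> < \<rho> / 2" if "x \<in> T" for x
        using N[of "n - 1" x] n that by simp
      obtain \<epsilon>1 where \<epsilon>1: "\<epsilon>1 > 0"
        "\<And>\<epsilon> x. 0 < \<epsilon> \<Longrightarrow> \<epsilon> \<le> \<epsilon>1 \<Longrightarrow> d (empiric_stochastic m f \<epsilon> n x) (empiric f n x) < \<rho> / 2"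
        using empiric_stochastic_uniformly_close[OF n1, of "\<rho> / 2"] \<rho> by auto
      then show ?thesis
        using zero_noise_triangle(1)[OF \<mu> n1] close by (intro exI[of _ \<epsilon>1]) auto
    qed
    then show ?thesis by (intro exI[of _ "Suc N"]) auto
  qed
  then show ?thesis using inv T(1,2) unfolding empirically_stochastically_stable_def by blast
qed

text \<open>The exceptional null sets may depend on \<open>n\<close> and on the noise level, but only one noise level is
  needed for each \<open>n\<close>, and countably many tolerances suffice.\<close>

lemma stable_imp_physical:
  assumes "empirically_stochastically_stable m f d \<mu>"
  shows "physical m f \<mu>"
proof -
  obtain S where inv: "\<mu> \<in> invariant_probs f" and S: "S \<in> sets m" "0 < emeasure m S"
    and st: "\<And>\<rho>. 0 < \<rho> \<Longrightarrow> \<exists>N\<ge>1. \<forall>n\<ge>N. \<exists>\<epsilon>0>0. \<forall>\<epsilon>. 0 < \<epsilon> \<and> \<epsilon> \<le> \<epsilon>0 \<longrightarrow>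
      (AE x in m. x \<in> S \<longrightarrow> d (empiric_stochastic m f \<epsilon> n x) \<mu> < \<rho>)"
    using assms unfolding empirically_stochastically_stable_def by blast
  then have \<mu>: "\<mu> \<in> borel_probs" by (simp add: invariant_probs_def)
  have "\<exists>N. \<forall>n\<ge>N. AE x in m. x \<in> S \<longrightarrow> d (empiric f n x) \<mu> < \<rho>" if \<rho>: "0 < \<rho>" for \<rho>
  proof -
    obtain N where N: "N \<ge> 1" "\<And>n. n \<ge> N \<Longrightarrow> \<exists>\<epsilon>0>0. \<forall>\<epsilon>. 0 < \<epsilon> \<and> \<epsilon> \<le> \<epsilon>0 \<longrightarrow>
      (AE x in m. x \<in> S \<longrightarrow> d (empiric_stochastic m f \<epsilon> n x) \<mu> < \<rho> / 2)"
      using st[of "\<rho> / 2"] \<rho> by auto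
    have "AE x in m. x \<in> S \<longrightarrow> d (empiric f n x) \<mu> < \<rho>" if "n \<ge> N" for n
    proof -
      have n: "n \<ge> 1" using N(1) that by simp
      obtain \<epsilon>0 where \<epsilon>0: "\<epsilon>0 > 0" "\<And>\<epsilon>. 0 < \<epsilon> \<Longrightarrow> \<epsilon> \<le> \<epsilon>0 \<Longrightarrow>
          AE x in m. x \<in> S \<longrightarrow> d (empiric_stochastic m f \<epsilon> n x) \<mu> < \<rho> / 2"
        using N(2)[OF \<open>n \<ge> N\<close>] by blast
      obtain \<epsilon>1 where \<epsilon>1: "\<epsilon>1 > 0"
        "\<And>\<epsilon> x. 0 < \<epsilon> \<Longrightarrow> \<epsilon> \<le> \<epsilon>1 \<Longrightarrow> d (empiric_stochastic m f \<epsilon> n x) (empiric f n x) < \<rho> / 2"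
        using empiric_stochastic_uniformly_close[OF n, of "\<rho> / 2"] \<rho> by auto
      define \<epsilon> where "\<epsilon> = min \<epsilon>0 \<epsilon>1"
      have \<epsilon>: "0 < \<epsilon>" "\<epsilon> \<le> \<epsilon>0" "\<epsilon> \<le> \<epsilon>1" using \<epsilon>0(1) \<epsilon>1(1) by (auto simp: \<epsilon>_def)
      show ?thesis
        using \<epsilon>0(2)[OF \<epsilon>(1,2)]
        by eventually_elim (use zero_noise_triangle(2)[OF \<mu> n \<epsilon>(1) \<epsilon>1(2)[OF \<epsilon>(1,3)]] in blast)
    qed
    then show ?thesis by blast
  qed
  then have "\<exists>N. \<forall>n\<ge>N. AE x in m. x \<in> S \<longrightarrow> d (empiric f n x) \<mu> < 1 / real (Suc k)" for k by simp
  then obtain N where "\<And>k n. n \<ge> N k \<Longrightarrow> AE x in m. x \<in> S \<longrightarrow> d (empiric f n x) \<mu> < 1 / real (Suc k)" by metis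
  then have "AE x in m. \<forall>k n. n \<ge> N k \<longrightarrow> x \<in> S \<longrightarrow> d (empiric f n x) \<mu> < 1 / real (Suc k)"
    by (simp add: AE_all_countable)
  then have "AE x in m. x \<in> S \<longrightarrow> x \<in> strong_basin f \<mu>"
  proof eventually_elim
    case (elim x)
    show ?case
      unfolding strong_basin_iff[OF \<mu>]
    proof (intro impI LIMSEQ_I)
      fix r :: real assume "x \<in> S" "0 < r"
      then obtain k where "1 / real (Suc k) < r" using nat_approx_posE by blast
      then show "\<exists>no. \<forall>n\<ge>no. norm (d (empiric f n x) \<mu> - 0) < r"
        using elim \<open>x \<in> S\<close> by (intro exI[of _ "N k"]) (auto intro: less_trans)
    qed
  qed
  then have "emeasure m S \<le> emeasure m (strong_basin f \<mu>)"
    by (rule emeasure_mono_AE) (rule strong_basin_sets[OF \<mu>])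
  then show ?thesis using inv S(2) by (auto simp: physical_def)
qed

end

theorem theorem1:
  fixes f :: "'a::metric_space \<Rightarrow> 'a"
    and A :: "('a, 'n::finite) chart set"
    and g :: "('a, 'n) metric_tensor"
    and m :: "'a measure"
    and d :: "'a measure \<Rightarrow> 'a measure \<Rightarrow> real"
    and \<mu> :: "'a measure"
  assumes "compact_riemannian_manifold A g m"
    and "Metric_space (borel_probs :: 'a measure set) d"
    and "Metric_space.mtopology (borel_probs :: 'a measure set) d = weak_star"
    and "continuous_on UNIV f"
    and "\<mu> \<in> invariant_probs f"
  shows "(empirically_stochastically_stable m f d \<mu> \<longleftrightarrow> physical m f \<mu>) \<and>
    (physical m f \<mu> \<longrightarrow> sym_diff (stochastic_basin m f d \<mu>) (strong_basin f \<mu>) \<in> null_sets m)"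
proof -
  interpret Metric_space borel_probs d by fact
  interpret random_perturbation d m f
    by (intro random_perturbation.intro metrized_weak_star.intro metrized_weak_star_axioms.intro
        random_perturbation_axioms.intro Metric_space_axioms compact_riemannian_manifold_volume[OF assms(1)])
      (use assms in \<open>simp_all add: compact_riemannian_manifold_def\<close>)
  have "stochastic_basin m f d \<mu> = strong_basin f \<mu>"
    using assms(5) by (intro stochastic_basin_eq_strong_basin) (simp add: invariant_probs_def)
  then show ?thesis using physical_imp_stable stable_imp_physical by auto
qed

end
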